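(* Let $k$ be a commutative ring with unit, let $R=k[x_1,\ldots,x_n]$, let $I=\langle f_1,\ldots,f_r\rangle\subset R$ be an ideal generated by $r$ elements, and set $A=R/I$. Let $J_r(A)$ be the $(n-r)$-th Fitting ideal of $\Omega_{A/k}$. Let $\delta\in\operatorname{Der}_k(A)$. If $\delta(A)\subset J_r(A)$, then $\delta\in\operatorname{IDer}_k(A)$. In particular, $J_r(A)\operatorname{Der}_k(A)\subset\operatorname{IDer}_k(A)$.
   Context: All rings are commutative with unit. $\operatorname{Der}_k(A)$ is the $A$-module of $k$-derivations $A\to A$. A Hasse-Schmidt derivation of $A$ over $k$ of length $\infty$ is a sequence $D=(D_0,D_1,D_2,\ldots)$ of $k$-linear maps $D_\alpha:A\to A$ with $D_0=\mathrm{Id}_A$ and $D_\alpha(xy)=\sum_{i+j=\alpha}D_i(x)D_j(y)$ for all $x,y\in A$ and all $\alpha$. A derivation $\delta\in\operatorname{Der}_k(A)$ is $\infty$-integrable if there is a Hasse-Schmidt derivation $D$ of length $\infty$ with $D_1=\delta$; $\operatorname{IDer}_k(A)$ denotes the $A$-submodule of $\operatorname{Der}_k(A)$ of $\infty$-integrable derivations. The $(n-r)$-th Fitting ideal $J_r(A)$ of $\Omega_{A/k}$ is the ideal of $A$ generated by the classes of the $r\times r$ minors of the Jacobian matrix $(\partial f_i/\partial x_j)$ of a set of generators of $I$ (it is the zero ideal if there are no such minors). *)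

theory Defs
  imports "HOL-Algebra.Algebra" "HOL-Combinatorics.Permutations"
begin

section \<open>The polynomial algebra in finitely many variables\<close>

text \<open>
  Polynomials over \<open>k\<close> in the variables \<open>x\<^sub>0, \<dots>, x\<^sub>n\<^sub>-\<^sub>1\<close> are the indexed polynomials of
  \<^theory>\<open>HOL-Algebra.Indexed_Polynomials\<close>: finitely supported coefficient functions on
  monomials, a monomial being a multiset of variables. That theory provides constants,
  addition and multiplication by a variable, but not the product of two polynomials.
\<close>

definition mpoly_mult ::
    "('a, 'm) ring_scheme \<Rightarrow> ('v multiset \<Rightarrow> 'a) \<Rightarrow> ('v multiset \<Rightarrow> 'a) \<Rightarrow> ('v multiset \<Rightarrow> 'a)"
  where "mpoly_mult k p q = (\<lambda>m. \<Oplus>\<^bsub>k\<^esub>a\<in>{a. a \<subseteq># m}. p a \<otimes>\<^bsub>k\<^esub> q (m - a))"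

definition mpoly_algebra :: "('a, 'm) ring_scheme \<Rightarrow> nat \<Rightarrow> ('a, nat multiset \<Rightarrow> 'a) module"
  where "mpoly_algebra k n =
    \<lparr>carrier = ring.indexed_pset k {..<n} (carrier k),
     monoid.mult = mpoly_mult k,
     one = ring.indexed_const k \<one>\<^bsub>k\<^esub>,
     ring.zero = ring.indexed_const k \<zero>\<^bsub>k\<^esub>,
     ring.add = ring.indexed_padd k,
     smult = (\<lambda>c p m. c \<otimes>\<^bsub>k\<^esub> p m)\<rparr>"

text \<open>The monomial \<open>m\<close> occurs in \<open>\<partial>p/\<partial>x\<^sub>j\<close> through the monomial \<open>m x\<^sub>j\<close> of \<open>p\<close>, whose
  exponent at \<open>x\<^sub>j\<close> is \<open>count m j + 1\<close>.\<close>

definition mpoly_pderiv ::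
    "('a, 'm) ring_scheme \<Rightarrow> 'v \<Rightarrow> ('v multiset \<Rightarrow> 'a) \<Rightarrow> ('v multiset \<Rightarrow> 'a)"
  where "mpoly_pderiv k j p = (\<lambda>m. add_pow k (Suc (count m j)) (p (add_mset j m)))"


section \<open>Quotient algebras\<close>

text \<open>\<^term>\<open>R Quot I\<close> with scalar multiplication on cosets,
  \<open>c (I + x) = I + c x\<close>, in the style of \<^const>\<open>rcoset_mult\<close>.\<close>

definition FactAlgebra :: "('a, 'b, 'm) module_scheme \<Rightarrow> 'b set \<Rightarrow> ('a, 'b set) module"
  where "FactAlgebra R I =
    ring.extend (R Quot I) (module.fields (\<lambda>c C. \<Union>x\<in>C. I +>\<^bsub>R\<^esub> (c \<odot>\<^bsub>R\<^esub> x)))"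


section \<open>Derivations and Hasse-Schmidt derivations\<close>

text \<open>Maps are extensional on the carrier, so that equality of maps is equality as functions
  \<open>A \<rightarrow> A\<close>.\<close>

definition linear_maps :: "('a, 'm) ring_scheme \<Rightarrow> ('a, 'b, 'n) module_scheme \<Rightarrow> ('b \<Rightarrow> 'b) set"
  where "linear_maps k A =
    {d \<in> carrier A \<rightarrow>\<^sub>E carrier A.
      (\<forall>x\<in>carrier A. \<forall>y\<in>carrier A. d (x \<oplus>\<^bsub>A\<^esub> y) = d x \<oplus>\<^bsub>A\<^esub> d y) \<and>
      (\<forall>c\<in>carrier k. \<forall>x\<in>carrier A. d (c \<odot>\<^bsub>A\<^esub> x) = c \<odot>\<^bsub>A\<^esub> d x)}"

text \<open>The \<open>A\<close>-module of \<open>k\<close>-derivations. As modules are ring records in HOL-Algebra,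
  the fields \<open>mult\<close> and \<open>one\<close> have to be filled but carry no meaning.\<close>

definition Der :: "('a, 'm) ring_scheme \<Rightarrow> ('a, 'b, 'n) module_scheme \<Rightarrow> ('b, 'b \<Rightarrow> 'b) module"
  where "Der k A =
    \<lparr>carrier = {d \<in> linear_maps k A. \<forall>x\<in>carrier A. \<forall>y\<in>carrier A.
       d (x \<otimes>\<^bsub>A\<^esub> y) = (d x \<otimes>\<^bsub>A\<^esub> y) \<oplus>\<^bsub>A\<^esub> (x \<otimes>\<^bsub>A\<^esub> d y)},
     monoid.mult = undefined,
     one = undefined,
     ring.zero = (\<lambda>x\<in>carrier A. \<zero>\<^bsub>A\<^esub>),
     ring.add = (\<lambda>d e. \<lambda>x\<in>carrier A. d x \<oplus>\<^bsub>A\<^esub> e x),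
     smult = (\<lambda>a d. \<lambda>x\<in>carrier A. a \<otimes>\<^bsub>A\<^esub> d x)\<rparr>"

definition HS :: "('a, 'm) ring_scheme \<Rightarrow> ('a, 'b, 'n) module_scheme \<Rightarrow> (nat \<Rightarrow> 'b \<Rightarrow> 'b) set"
  where "HS k A =
    {D. (\<forall>\<alpha>. D \<alpha> \<in> linear_maps k A) \<and>
        D 0 = (\<lambda>x\<in>carrier A. x) \<and>
        (\<forall>\<alpha>. \<forall>x\<in>carrier A. \<forall>y\<in>carrier A.
          D \<alpha> (x \<otimes>\<^bsub>A\<^esub> y) = (\<Oplus>\<^bsub>A\<^esub>i\<in>{..\<alpha>}. D i x \<otimes>\<^bsub>A\<^esub> D (\<alpha> - i) y))}"

definition IDer :: "('a, 'm) ring_scheme \<Rightarrow> ('a, 'b, 'n) module_scheme \<Rightarrow> ('b \<Rightarrow> 'b) set"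
  where "IDer k A = {\<delta> \<in> carrier (Der k A). \<exists>D\<in>HS k A. D 1 = \<delta>}"

text \<open>The submodule \<open>J M\<close> for an ideal \<open>J\<close> of the scalar ring: all finite sums of products
  \<open>a x\<close> (compare \<^const>\<open>ideal_prod\<close>).\<close>

inductive_set ideal_smult :: "'a set \<Rightarrow> ('a, 'b, 'm) module_scheme \<Rightarrow> 'b set"
  for J and M where
    zero: "\<zero>\<^bsub>M\<^esub> \<in> ideal_smult J M"
  | smult: "\<lbrakk> a \<in> J; x \<in> carrier M \<rbrakk> \<Longrightarrow> a \<odot>\<^bsub>M\<^esub> x \<in> ideal_smult J M"
  | add: "\<lbrakk> u \<in> ideal_smult J M; v \<in> ideal_smult J M \<rbrakk> \<Longrightarrow> u \<oplus>\<^bsub>M\<^esub> v \<in> ideal_smult J M"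


section \<open>Jacobian minors and the Fitting ideal\<close>

definition ring_det :: "('a, 'm) ring_scheme \<Rightarrow> nat \<Rightarrow> (nat \<Rightarrow> nat \<Rightarrow> 'a) \<Rightarrow> 'a"
  where "ring_det R r M =
    (\<Oplus>\<^bsub>R\<^esub>p\<in>{p. p permutes {..<r}}.
      if evenperm p then \<Otimes>\<^bsub>R\<^esub>i\<in>{..<r}. M i (p i)
      else \<ominus>\<^bsub>R\<^esub> (\<Otimes>\<^bsub>R\<^esub>i\<in>{..<r}. M i (p i)))"

text \<open>The \<open>r \<times> r\<close> minors of the Jacobian matrix of \<open>f\<^sub>0, \<dots>, f\<^sub>m\<^sub>-\<^sub>1\<close>; \<open>\<rho>\<close> and \<open>\<gamma>\<close> enumerate in
  increasing order the rows and the columns of the chosen submatrix.\<close>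

definition jacobian_minors ::
    "('a, 'm) ring_scheme \<Rightarrow> nat \<Rightarrow> nat \<Rightarrow> (nat \<Rightarrow> nat multiset \<Rightarrow> 'a) \<Rightarrow> nat \<Rightarrow> (nat multiset \<Rightarrow> 'a) set"
  where "jacobian_minors k n m f r =
    {ring_det (mpoly_algebra k n) r (\<lambda>i j. mpoly_pderiv k (\<gamma> j) (f (\<rho> i))) | \<rho> \<gamma>.
      strict_mono_on {..<r} \<rho> \<and> \<rho> ` {..<r} \<subseteq> {..<m} \<and>
      strict_mono_on {..<r} \<gamma> \<and> \<gamma> ` {..<r} \<subseteq> {..<n}}"

text \<open>The ideal \<open>J\<^sub>r(A)\<close>, i.e. the \<open>(n - r)\<close>-th Fitting ideal of \<open>\<Omega>\<^bsub>A/k\<^esub>\<close>, of \<open>A = k[x]/I\<close> with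
  \<open>I\<close> generated by \<open>f\<^sub>0, \<dots>, f\<^sub>m\<^sub>-\<^sub>1\<close>. If there are no \<open>r \<times> r\<close> minors it is the zero ideal, and for
  \<open>r = 0\<close> the empty minor is \<open>1\<close>.\<close>

definition Fitting_ideal ::
    "('a, 'm) ring_scheme \<Rightarrow> nat \<Rightarrow> nat \<Rightarrow> (nat \<Rightarrow> nat multiset \<Rightarrow> 'a) \<Rightarrow> nat \<Rightarrow> (nat multiset \<Rightarrow> 'a) set set"
  where "Fitting_ideal k n m f r =
    (let R = mpoly_algebra k n; I = Idl\<^bsub>R\<^esub> (f ` {..<m})
     in Idl\<^bsub>FactAlgebra R I\<^esub> ((\<lambda>p. I +>\<^bsub>R\<^esub> p) ` jacobian_minors k n m f r))"

end

theory Submission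
  imports Defs "Jordan_Normal_Form.Missing_Ring"
begin

text \<open>
  A Hasse-Schmidt derivation with first component \<open>\<delta>\<close> is built one order at a time, under the
  invariant that every \<open>D\<^sub>i\<close> with \<open>i \<ge> 1\<close> maps \<open>A\<close> into the ideal \<open>J\<close> of Jacobian minors.

  Suppose that \<open>D\<^sub>0, \<dots>, D\<^sub>N\<^sub>-\<^sub>1\<close> are given. Since polynomial algebras are free, there is an algebra
  homomorphism \<open>k[x\<^sub>0, \<dots>, x\<^sub>n\<^sub>-\<^sub>1] \<rightarrow> A[t]\<close> sending \<open>x\<^sub>j\<close> to the sum of the \<open>D\<^sub>i(x\<^sub>j) t\<^sup>i\<close> over \<open>i < N\<close>. Its
  coefficients of order below \<open>N\<close> are the \<open>D\<^sub>i\<close>, and its coefficient \<open>E\<close> of order \<open>N\<close> satisfies the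
  Leibniz rule of order \<open>N\<close>; but \<open>E\<close> need not vanish on the relations \<open>f\<^sub>0, \<dots>, f\<^sub>r\<^sub>-\<^sub>1\<close>, so it need not
  descend to \<open>A\<close>. As \<open>E\<close> vanishes on constants and variables, all its values are
  \<open>A\<close>-linear combinations of products \<open>D\<^sub>a(y) D\<^sub>b(z)\<close> with \<open>a, b \<ge> 1\<close>, and hence lie in \<open>J\<^sup>2\<close>. This is
  \<open>lift_to_polynomial_ring\<close>.

  The Leibniz rule of order \<open>N\<close> survives if an ordinary derivation is added to \<open>E\<close>.
  Adding the sum of the \<open>w\<^sub>j \<partial>/\<partial>x\<^sub>j\<close> makes it vanish on the relations as soon as \<open>w\<close> solves the
  linear system with the Jacobian matrix on the left and \<open>-E(f\<^sub>i)\<close> on the right. The minors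
  that generate \<open>J\<close> use all rows of that matrix, so the adjugate of a square submatrix with determinant
  \<open>\<Delta>\<close> solves every system whose right-hand side is a multiple \<open>\<Delta> z\<close>, by a vector that is linear in
  \<open>z\<close>. A right-hand side in \<open>J\<^sup>2\<close> is a sum of such multiples with \<open>z\<close> in \<open>J\<close>: one factor \<open>J\<close>
  pays for the division by the Jacobian, and the other one puts the solution \<open>w\<close> into \<open>J\<close>
  (\<open>linear_system_solvable\<close>). The corrected map therefore descends to a map \<open>D\<^sub>N\<close> on \<open>A\<close> with values in
  \<open>J\<close>, which is the invariant for the next order (\<open>hs_extend\<close>).

  Elements of \<open>J Der\<^sub>k(A)\<close> are derivations with image in \<open>J\<close>, so they are covered as well.
\<close>

section \<open>The ring structure of the polynomial algebra\<close>

lemma finite_submsets: "finite {a. a \<subseteq># (m :: 'v multiset)}"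
proof (induction m)
  case (add x m)
  have "{a. a \<subseteq># add_mset x m} \<subseteq> {a. a \<subseteq># m} \<union> add_mset x ` {a. a \<subseteq># m}"
  proof
    fix a assume a: "a \<in> {a. a \<subseteq># add_mset x m}"
    show "a \<in> {a. a \<subseteq># m} \<union> add_mset x ` {a. a \<subseteq># m}"
    proof (cases "x \<in># a")
      case True
      then obtain b where "a = add_mset x b" by (meson multi_member_split)
      with a show ?thesis by auto
    next
      case False
      with a show ?thesis
        by (auto simp: subseteq_mset_def not_in_iff split: if_splits) (metis count_add_mset le0)
    qed
  qed
  then show ?case by (rule finite_subset) (use add in auto)
qed simp

context cring
begin

lemma mpoly_mult_carrier_coeff:
  assumes "carrier_coeff p" "carrier_coeff q"
  shows "carrier_coeff (mpoly_mult R p q)"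
  using assms unfolding carrier_coeff_def mpoly_mult_def
  by (auto intro!: finsum_closed)

text \<open>The involution \<open>a \<mapsto> m - a\<close> of the divisors of a monomial \<open>m\<close> exchanges the two factors.\<close>

lemma mpoly_mult_comm:
  fixes p q :: "'v multiset \<Rightarrow> 'a"
  assumes "carrier_coeff p" "carrier_coeff q"
  shows "mpoly_mult R p q = mpoly_mult R q p"
proof
  fix m :: "'v multiset"
  have cl: "p a \<in> carrier R" "q a \<in> carrier R" for a
    using assms by (auto simp: carrier_coeff_def)
  have dd: "m - (m - a) = a" if "a \<subseteq># m" for a
    using that by (metis subset_mset.add_diff_inverse add_diff_cancel_right')
  have inj: "inj_on (\<lambda>a. m - a) {a. a \<subseteq># m}"
    by (rule inj_onI) (metis mem_Collect_eq dd)
  have im: "(\<lambda>a. m - a) ` {a. a \<subseteq># m} = {a. a \<subseteq># m}"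
  proof (intro equalityI subsetI)
    fix x assume "x \<in> {a. a \<subseteq># m}"
    then show "x \<in> (\<lambda>a. m - a) ` {a. a \<subseteq># m}"
      using dd[of x] by (metis (mono_tags) diff_subset_eq_self imageI mem_Collect_eq)
  qed auto
  have "mpoly_mult R p q m = (\<Oplus>a\<in>(\<lambda>a. m - a) ` {a. a \<subseteq># m}. p a \<otimes> q (m - a))"
    unfolding im mpoly_mult_def by simp
  also have "\<dots> = (\<Oplus>a\<in>{a. a \<subseteq># m}. p (m - a) \<otimes> q (m - (m - a)))"
    by (rule finsum_reindex) (use cl inj in auto)
  also have "\<dots> = mpoly_mult R q p m"
    unfolding mpoly_mult_def
    by (rule finsum_cong') (use cl dd in \<open>auto simp: m_comm\<close>)
  finally show "mpoly_mult R p q m = mpoly_mult R q p m" .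
qed

lemma mpoly_mult_const:
  assumes "c \<in> carrier R" "carrier_coeff q"
  shows "mpoly_mult R (indexed_const c) q = (\<lambda>m. c \<otimes> q m)"
proof
  fix m
  have cl: "q a \<in> carrier R" for a
    using assms by (auto simp: carrier_coeff_def)
  have "mpoly_mult R (indexed_const c) q m
      = (\<Oplus>a\<in>{{#}}. c \<otimes> q (m - a))"
    unfolding mpoly_mult_def
    by (rule add.finprod_mono_neutral_cong_right)
       (use cl assms finite_submsets in \<open>auto simp: indexed_const_def\<close>)
  also have "\<dots> = c \<otimes> q m"
    using cl assms by simp
  finally show "mpoly_mult R (indexed_const c) q m = c \<otimes> q m" .
qed

lemma mpoly_mult_padd:
  assumes "carrier_coeff p" "carrier_coeff p'" "carrier_coeff q"
  shows "mpoly_mult R (indexed_padd p p') q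
    = indexed_padd (mpoly_mult R p q) (mpoly_mult R p' q)"
proof
  fix m
  have cl: "p a \<in> carrier R" "p' a \<in> carrier R" "q a \<in> carrier R" for a
    using assms by (auto simp: carrier_coeff_def)
  show "mpoly_mult R (indexed_padd p p') q m
    = indexed_padd (mpoly_mult R p q) (mpoly_mult R p' q) m"
    unfolding mpoly_mult_def indexed_padd_def
    by (subst finsum_addf[symmetric]) (use cl in \<open>auto intro!: finsum_cong' simp: l_distr\<close>)
qed

text \<open>Together with \<open>mpoly_mult_const\<close> and \<open>mpoly_mult_padd\<close> this describes the convolution product by
recursion on its first factor along the inductive definition of polynomials. The ring axioms and all
multiplicativity statements below follow by that induction, without reordering double sums.\<close>

lemma mpoly_mult_pmult:
  assumes "carrier_coeff p" "carrier_coeff q"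
  shows "mpoly_mult R (indexed_pmult p i) q = indexed_pmult (mpoly_mult R p q) i"
proof
  fix m
  have cl: "p a \<in> carrier R" "q a \<in> carrier R" for a
    using assms by (auto simp: carrier_coeff_def)
  show "mpoly_mult R (indexed_pmult p i) q m = indexed_pmult (mpoly_mult R p q) i m"
  proof (cases "i \<in># m")
    case False
    have "i \<notin># a" if "a \<subseteq># m" for a
      using False that mset_subset_eqD by fastforce
    then show ?thesis
      using False cl unfolding mpoly_mult_def indexed_pmult_def
      by (auto intro!: add.finprod_one_eqI)
  next
    case True
    then obtain m' where m: "m = add_mset i m'" by (meson multi_member_split)
    have "mpoly_mult R (indexed_pmult p i) q m
        = (\<Oplus>a\<in>add_mset i ` {a. a \<subseteq># m'}. p (a - {#i#}) \<otimes> q (m - a))"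
      unfolding mpoly_mult_def
    proof (rule add.finprod_mono_neutral_cong_right)
      show "finite {a. a \<subseteq># m}" by (rule finite_submsets)
      show "add_mset i ` {a. a \<subseteq># m'} \<subseteq> {a. a \<subseteq># m}" by (auto simp: m)
      fix a
      assume a: "a \<in> {a. a \<subseteq># m} - add_mset i ` {a. a \<subseteq># m'}"
      have "i \<notin># a"
      proof
        assume "i \<in># a"
        then obtain b where "a = add_mset i b" by (meson multi_member_split)
        with a show False by (auto simp: m)
      qed
      then show "indexed_pmult p i a \<otimes> q (m - a) = \<zero>"
        using cl by (simp add: indexed_pmult_def)
    qed (use cl in \<open>auto simp: indexed_pmult_def\<close>)
    also have "\<dots> = (\<Oplus>a\<in>{a. a \<subseteq># m'}. p a \<otimes> q (m' - a))"
      by (subst finsum_reindex) (use cl in \<open>auto simp: m inj_on_def\<close>)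
    also have "\<dots> = indexed_pmult (mpoly_mult R p q) i m"
      using True by (simp add: indexed_pmult_def mpoly_mult_def m)
    finally show ?thesis .
  qed
qed

lemma mpoly_algebra_simps:
  "carrier (mpoly_algebra R n) = indexed_pset {..<n} (carrier R)"
  "p \<otimes>\<^bsub>mpoly_algebra R n\<^esub> q = mpoly_mult R p q"
  "\<one>\<^bsub>mpoly_algebra R n\<^esub> = indexed_const \<one>"
  "\<zero>\<^bsub>mpoly_algebra R n\<^esub> = indexed_const \<zero>"
  "p \<oplus>\<^bsub>mpoly_algebra R n\<^esub> q = indexed_padd p q"
  "c \<odot>\<^bsub>mpoly_algebra R n\<^esub> p = (\<lambda>m. c \<otimes> p m)"
  by (simp_all add: mpoly_algebra_def)

lemma mpoly_carrier_coeff: "p \<in> indexed_pset V (carrier R) \<Longrightarrow> carrier_coeff p"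
  using indexed_pset_in_carrier by blast

lemma finite_mpoly_support:
  "p \<in> indexed_pset V (carrier R) \<Longrightarrow> finite {m. p m \<noteq> \<zero>}"
proof (induction rule: indexed_pset.induct)
  case (indexed_const c)
  show ?case by (rule finite_subset[of _ "{{#}}"]) (auto simp: indexed_const_def)
next
  case (indexed_padd p q)
  show ?case
    by (rule finite_subset[OF _ finite_UnI[OF indexed_padd.IH]]) (auto simp: indexed_padd_def)
next
  case (indexed_pmult p i)
  have "{m. indexed_pmult p i m \<noteq> \<zero>} \<subseteq> add_mset i ` {m. p m \<noteq> \<zero>}"
    by (auto simp: indexed_pmult_def image_iff split: if_splits intro!: exI[of _ "_ - {#i#}"])
  then show ?case by (rule finite_subset) (use indexed_pmult.IH in auto)
qed

lemma mpoly_smult_closed: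
  fixes q :: "'v multiset \<Rightarrow> 'a"
  assumes c: "c \<in> carrier R" and "q \<in> indexed_pset V (carrier R)"
  shows "(\<lambda>m. c \<otimes> q m) \<in> indexed_pset V (carrier R)"
  using assms(2)
proof (induction rule: indexed_pset.induct)
  case (indexed_const d)
  have "(\<lambda>m :: 'v multiset. c \<otimes> indexed_const d m) = indexed_const (c \<otimes> d)"
    using c by (auto simp: indexed_const_def)
  then show ?case using c indexed_const by (simp add: indexed_pset.indexed_const)
next
  case (indexed_padd p q)
  have "(\<lambda>m. c \<otimes> indexed_padd p q m) = indexed_padd (\<lambda>m. c \<otimes> p m) (\<lambda>m. c \<otimes> q m)"
    using c indexed_padd mpoly_carrier_coeff[of _ V] 
    by (auto simp: indexed_padd_def r_distr carrier_coeff_def)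
  then show ?case using indexed_padd indexed_pset.indexed_padd by auto
next
  case (indexed_pmult p i)
  have "(\<lambda>m. c \<otimes> indexed_pmult p i m) = indexed_pmult (\<lambda>m. c \<otimes> p m) i"
    using c by (auto simp: indexed_pmult_def)
  then show ?case using indexed_pmult indexed_pset.indexed_pmult by metis
qed

lemma mpoly_mult_in_pset:
  assumes "p \<in> indexed_pset V (carrier R)" and q: "q \<in> indexed_pset V (carrier R)"
  shows "mpoly_mult R p q \<in> indexed_pset V (carrier R)"
  using assms(1)
proof (induction rule: indexed_pset.induct)
  case (indexed_const c)
  then show ?case by (simp add: mpoly_mult_const mpoly_carrier_coeff[OF q] mpoly_smult_closed[OF _ q])
next
  case (indexed_padd p p')
  then show ?case
    by (simp add: mpoly_mult_padd mpoly_carrier_coeff[of _ V] mpoly_carrier_coeff[OF q] indexed_pset.indexed_padd)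
next
  case (indexed_pmult p i)
  then show ?case
    by (simp add: mpoly_mult_pmult mpoly_carrier_coeff[of _ V] mpoly_carrier_coeff[OF q] indexed_pset.indexed_pmult)
qed

lemma mpoly_mult_assoc:
  assumes "p \<in> indexed_pset V (carrier R)" 
    and q: "q \<in> indexed_pset V (carrier R)" and s: "s \<in> indexed_pset V (carrier R)"
  shows "mpoly_mult R (mpoly_mult R p q) s = mpoly_mult R p (mpoly_mult R q s)"
  using assms(1)
proof (induction rule: indexed_pset.induct)
  case (indexed_const c)
  have cl: "q a \<in> carrier R" "s a \<in> carrier R" for a
    using mpoly_carrier_coeff[OF q] mpoly_carrier_coeff[OF s] by (auto simp: carrier_coeff_def)
  have "mpoly_mult R (\<lambda>m. c \<otimes> q m) s = (\<lambda>m. c \<otimes> mpoly_mult R q s m)"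
    unfolding mpoly_mult_def
    using indexed_const cl
    by (subst finsum_rdistr[OF finite_submsets])
       (auto simp: m_assoc fun_eq_iff intro!: finsum_cong')
  then show ?case
    using indexed_const
    by (simp add: mpoly_mult_const mpoly_carrier_coeff[OF q] mpoly_carrier_coeff[OF s] mpoly_mult_carrier_coeff)
next
  case (indexed_padd p p')
  then show ?case
    by (simp add: mpoly_mult_padd mpoly_carrier_coeff[of _ V] mpoly_carrier_coeff[OF q] mpoly_carrier_coeff[OF s]
        mpoly_mult_carrier_coeff)
next
  case (indexed_pmult p i)
  then show ?case
    by (simp add: mpoly_mult_pmult mpoly_carrier_coeff[of _ V] mpoly_carrier_coeff[OF q] mpoly_carrier_coeff[OF s]
        mpoly_mult_carrier_coeff)
qed

theorem mpoly_algebra_cring: "cring (mpoly_algebra R n)"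
proof (rule cringI)
  show "abelian_group (mpoly_algebra R n)"
  proof (rule abelian_groupI)
    fix p assume "p \<in> carrier (mpoly_algebra R n)"
    then have p: "p \<in> indexed_pset {..<n} (carrier R)" by (simp add: mpoly_algebra_simps)
    have "(\<lambda>m. \<ominus> \<one> \<otimes> p m) \<in> carrier (mpoly_algebra R n)"
      using mpoly_smult_closed[OF _ p] by (simp add: mpoly_algebra_simps)
    moreover have "indexed_padd (\<lambda>m. \<ominus> \<one> \<otimes> p m) p = indexed_const \<zero>"
      using mpoly_carrier_coeff[OF p]
      by (auto simp: indexed_padd_def indexed_const_def carrier_coeff_def l_minus l_neg)
    ultimately show "\<exists>q\<in>carrier (mpoly_algebra R n).
        q \<oplus>\<^bsub>mpoly_algebra R n\<^esub> p = \<zero>\<^bsub>mpoly_algebra R n\<^esub>"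
      by (auto simp: mpoly_algebra_simps)
  qed (auto simp: mpoly_algebra_simps indexed_padd_zero mpoly_carrier_coeff[of _ "{..<n}"] indexed_pset.intros,
       auto simp: indexed_padd_def fun_eq_iff carrier_coeff_def a_ac dest!: mpoly_carrier_coeff)
  show "comm_monoid (mpoly_algebra R n)"
  proof (rule comm_monoidI)
    fix p assume "p \<in> carrier (mpoly_algebra R n)"
    then have p: "p \<in> indexed_pset {..<n} (carrier R)" by (simp add: mpoly_algebra_simps)
    then show "\<one>\<^bsub>mpoly_algebra R n\<^esub> \<otimes>\<^bsub>mpoly_algebra R n\<^esub> p = p"
      using mpoly_carrier_coeff[OF p]
      by (simp add: mpoly_algebra_simps mpoly_mult_const) (simp add: carrier_coeff_def)
  qed (auto simp: mpoly_algebra_simps mpoly_mult_in_pset mpoly_mult_assoc[of _ "{..<n}"]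
         indexed_pset.intros intro!: mpoly_mult_comm mpoly_carrier_coeff[of _ "{..<n}"])
qed (auto simp: mpoly_algebra_simps intro!: mpoly_mult_padd mpoly_carrier_coeff[of _ "{..<n}"])

lemma indexed_pmult_eq_var_mult:
  fixes p :: "'v multiset \<Rightarrow> 'a"
  assumes "carrier_coeff p"
  shows "indexed_pmult p i = mpoly_mult R (indexed_var i) p"
proof -
  have "carrier_coeff (indexed_const \<one> :: 'v multiset \<Rightarrow> 'a)" by (simp add: carrier_coeff_def indexed_const_def)
  then show ?thesis
    using assms unfolding indexed_var_def
    by (simp add: mpoly_mult_pmult mpoly_mult_const) (simp add: carrier_coeff_def)
qed

lemma mpoly_const_closed: "c \<in> carrier R \<Longrightarrow> indexed_const c \<in> carrier (mpoly_algebra R n)"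
  by (simp add: mpoly_algebra_simps indexed_pset.intros)

lemma mpoly_var_closed: "i < n \<Longrightarrow> indexed_var i \<in> carrier (mpoly_algebra R n)"
  by (simp add: mpoly_algebra_simps indexed_pset.intros indexed_var_def)

lemma mpoly_const_hom: "indexed_const \<in> ring_hom R (mpoly_algebra R n)"
proof (rule ring_hom_memI)
  fix x y assume "x \<in> carrier R" "y \<in> carrier R"
  moreover from this have "carrier_coeff (indexed_const y :: nat multiset \<Rightarrow> 'a)"
    by (simp add: carrier_coeff_def indexed_const_def)
  ultimately show "indexed_const (x \<otimes> y)
      = indexed_const x \<otimes>\<^bsub>mpoly_algebra R n\<^esub> indexed_const y"
    by (auto simp add: mpoly_algebra_simps mpoly_mult_const)
       (auto simp: indexed_const_def)
qed (simp_all add: mpoly_const_closed, simp_all add: mpoly_algebra_simps indexed_padd_const)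

lemma mpoly_smult_eq:
  assumes "c \<in> carrier R" "p \<in> carrier (mpoly_algebra R n)"
  shows "c \<odot>\<^bsub>mpoly_algebra R n\<^esub> p = indexed_const c \<otimes>\<^bsub>mpoly_algebra R n\<^esub> p"
  using assms mpoly_carrier_coeff[of p] by (simp add: mpoly_algebra_simps mpoly_mult_const)

text \<open>Induction phrased in the operations of the algebra itself, with constants and variables as
generators: later arguments never look at coefficients.\<close>

lemma mpoly_induct [consumes 1, case_names const add var]:
  assumes "p \<in> carrier (mpoly_algebra R n)"
    and "\<And>c. c \<in> carrier R \<Longrightarrow> Q (indexed_const c)"
    and "\<And>p q. \<lbrakk>p \<in> carrier (mpoly_algebra R n); q \<in> carrier (mpoly_algebra R n); Q p; Q q\<rbrakk>
          \<Longrightarrow> Q (p \<oplus>\<^bsub>mpoly_algebra R n\<^esub> q)"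
    and "\<And>i p. \<lbrakk>i < n; p \<in> carrier (mpoly_algebra R n); Q p\<rbrakk>
          \<Longrightarrow> Q (indexed_var i \<otimes>\<^bsub>mpoly_algebra R n\<^esub> p)"
  shows "Q p"
proof -
  have "p \<in> indexed_pset {..<n} (carrier R)" using assms(1) by (simp add: mpoly_algebra_simps)
  then show ?thesis
  proof (induction rule: indexed_pset.induct)
    case (indexed_pmult p i)
    then show ?case
      using assms(4)[of i p] mpoly_carrier_coeff[OF indexed_pmult.hyps(1)]
      by (simp add: mpoly_algebra_simps indexed_pmult_eq_var_mult)
  qed (use assms in \<open>auto simp: mpoly_algebra_simps\<close>)
qed


section \<open>Partial derivatives\<close>

lemma mpoly_pderiv_const:
  "mpoly_pderiv R j (indexed_const c) = indexed_const \<zero>"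
  by (auto simp: mpoly_pderiv_def indexed_const_def simp del: add.nat_pow_Suc)

lemma mpoly_pderiv_padd:
  assumes "carrier_coeff p" "carrier_coeff q"
  shows "mpoly_pderiv R j (indexed_padd p q)
    = indexed_padd (mpoly_pderiv R j p) (mpoly_pderiv R j q)"
  using assms unfolding mpoly_pderiv_def indexed_padd_def carrier_coeff_def
  by (auto simp: add.nat_pow_distrib simp del: add.nat_pow_Suc)

text \<open>The product rule for a variable; the factor \<open>count m j + 1\<close> in the derivative splits off
the extra copy of \<open>p\<close> that appears when \<open>i = j\<close>.\<close>

lemma mpoly_pderiv_pmult:
  assumes "carrier_coeff p"
  shows "mpoly_pderiv R j (indexed_pmult p i)
    = indexed_padd (indexed_pmult (mpoly_pderiv R j p) i) (if i = j then p else indexed_const \<zero>)"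
proof
  fix m
  have cl: "p a \<in> carrier R" for a using assms by (simp add: carrier_coeff_def)
  show "mpoly_pderiv R j (indexed_pmult p i) m
    = indexed_padd (indexed_pmult (mpoly_pderiv R j p) i) (if i = j then p else indexed_const \<zero>) m"
  proof (cases "i \<in># m")
    case True
    then obtain m' where "m = add_mset i m'" by (meson multi_member_split)
    then show ?thesis
      using cl by (auto simp: mpoly_pderiv_def indexed_pmult_def indexed_padd_def
        indexed_const_def add_mset_commute)
  next
    case False
    then have "count m i = 0" by (simp add: not_in_iff)
    with False show ?thesis
      using cl by (auto simp: mpoly_pderiv_def indexed_pmult_def indexed_padd_def
        indexed_const_def)
  qed
qed

lemma mpoly_pderiv_carrier_coeff: "carrier_coeff p \<Longrightarrow> carrier_coeff (mpoly_pderiv R j p)"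
  by (simp add: carrier_coeff_def mpoly_pderiv_def)

lemma mpoly_pderiv_in_pset:
  "p \<in> indexed_pset V (carrier R) \<Longrightarrow> mpoly_pderiv R j p \<in> indexed_pset V (carrier R)"
proof (induction rule: indexed_pset.induct)
  case (indexed_pmult p i)
  then show ?case
    by (simp add: mpoly_pderiv_pmult mpoly_carrier_coeff[of _ V] indexed_pset.intros)
qed (simp_all add: mpoly_pderiv_const mpoly_pderiv_padd mpoly_carrier_coeff[of _ V] indexed_pset.intros)

lemma mpoly_pderiv_mult:
  assumes "p \<in> indexed_pset V (carrier R)" and q: "q \<in> indexed_pset V (carrier R)"
  shows "mpoly_pderiv R j (mpoly_mult R p q)
    = indexed_padd (mpoly_mult R (mpoly_pderiv R j p) q) (mpoly_mult R p (mpoly_pderiv R j q))"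
  using assms(1)
proof (induction rule: indexed_pset.induct)
  case (indexed_const c)
  have cl: "q a \<in> carrier R" for a
    using mpoly_carrier_coeff[OF q] by (auto simp: carrier_coeff_def)
  show ?case
    using indexed_const cl
    by (simp add: mpoly_pderiv_const mpoly_mult_const mpoly_carrier_coeff[OF q] mpoly_pderiv_carrier_coeff)
       (auto simp: mpoly_pderiv_def indexed_padd_def add_pow_rdistr simp del: add.nat_pow_Suc)
next
  case (indexed_padd p p')
  note c = mpoly_carrier_coeff[of _ V] mpoly_carrier_coeff[OF q] mpoly_pderiv_carrier_coeff mpoly_mult_carrier_coeff
  have "a \<oplus> b \<oplus> (c \<oplus> d) = a \<oplus> c \<oplus> (b \<oplus> d)"
    if "a \<in> carrier R" "b \<in> carrier R" "c \<in> carrier R" "d \<in> carrier R" for a b c d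
    using that by algebra
  then have swap: "indexed_padd (indexed_padd a b) (indexed_padd c d)
      = indexed_padd (indexed_padd a c) (indexed_padd b d)"
    if "carrier_coeff a" "carrier_coeff b" "carrier_coeff c" "carrier_coeff d" for a b c d
    using that by (simp add: indexed_padd_def carrier_coeff_def fun_eq_iff)
  from indexed_padd show ?case
    by (simp add: mpoly_mult_padd mpoly_pderiv_padd c swap)
next
  case (indexed_pmult p i)
  note c = mpoly_carrier_coeff[of _ V] mpoly_carrier_coeff[OF q] mpoly_pderiv_carrier_coeff mpoly_mult_carrier_coeff
    indexed_pmult_in_carrier
  have z: "carrier_coeff (indexed_const \<zero>)" by (simp add: carrier_coeff_def indexed_const_def)
  have pp: "carrier_coeff p" using indexed_pmult c by simp
  have z': "mpoly_mult R (indexed_const \<zero>) q = indexed_const \<zero>"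
    using mpoly_carrier_coeff[OF q] 
    by (simp add: mpoly_mult_const) (auto simp: carrier_coeff_def indexed_const_def)
  have "a \<oplus> b \<oplus> c = a \<oplus> c \<oplus> b"
    if "a \<in> carrier R" "b \<in> carrier R" "c \<in> carrier R" for a b c
    using that by algebra
  then have swap: "indexed_padd (indexed_pmult (indexed_padd a b) i) c
      = indexed_padd (indexed_padd (indexed_pmult a i) c) (indexed_pmult b i)"
    if "carrier_coeff a" "carrier_coeff b" "carrier_coeff c" for a b c i
    using that by (auto simp: indexed_padd_def indexed_pmult_def carrier_coeff_def fun_eq_iff)
  from indexed_pmult show ?case
    by (auto simp: mpoly_mult_padd mpoly_mult_pmult mpoly_pderiv_pmult c z z' swap)
qed

end

section \<open>The universal property of the polynomial algebra\<close>

context ring_hom_cring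
begin

definition mpoly_monomial :: "(nat \<Rightarrow> 'c) \<Rightarrow> nat \<Rightarrow> nat multiset \<Rightarrow> 'c"
  where "mpoly_monomial s n m = (\<Otimes>\<^bsub>S\<^esub>i\<in>{..<n}. s i [^]\<^bsub>S\<^esub> count m i)"

definition mpoly_eval :: "(nat \<Rightarrow> 'c) \<Rightarrow> nat \<Rightarrow> (nat multiset \<Rightarrow> 'a) \<Rightarrow> 'c"
  where "mpoly_eval s n p = (\<Oplus>\<^bsub>S\<^esub>m\<in>{m. p m \<noteq> \<zero>\<^bsub>R\<^esub>}. h (p m) \<otimes>\<^bsub>S\<^esub> mpoly_monomial s n m)"

lemma mpoly_monomial_closed:
  "s \<in> {..<n} \<rightarrow> carrier S \<Longrightarrow> mpoly_monomial s n m \<in> carrier S"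
  unfolding mpoly_monomial_def by (auto intro!: S.finprod_closed)

lemma mpoly_monomial_empty:
  "s \<in> {..<n} \<rightarrow> carrier S \<Longrightarrow> mpoly_monomial s n {#} = \<one>\<^bsub>S\<^esub>"
  unfolding mpoly_monomial_def by (auto intro!: S.finprod_one_eqI)

lemma mpoly_monomial_add:
  assumes s: "s \<in> {..<n} \<rightarrow> carrier S" and i: "i < n"
  shows "mpoly_monomial s n (add_mset i m) = s i \<otimes>\<^bsub>S\<^esub> mpoly_monomial s n m"
proof -
  have cl: "s j \<in> carrier S" if "j < n" for j using s that by auto
  have "mpoly_monomial s n (add_mset i m)
      = (\<Otimes>\<^bsub>S\<^esub>j\<in>{..<n}. (if i = j then s j else \<one>\<^bsub>S\<^esub>) \<otimes>\<^bsub>S\<^esub> s j [^]\<^bsub>S\<^esub> count m j)"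
    unfolding mpoly_monomial_def
    by (rule S.finprod_cong') (use cl in \<open>auto simp: S.m_comm\<close>)
  also have "\<dots> = (\<Otimes>\<^bsub>S\<^esub>j\<in>{..<n}. if i = j then s j else \<one>\<^bsub>S\<^esub>) \<otimes>\<^bsub>S\<^esub> mpoly_monomial s n m"
    unfolding mpoly_monomial_def by (rule S.finprod_multf) (use cl in auto)
  also have "(\<Otimes>\<^bsub>S\<^esub>j\<in>{..<n}. if i = j then s j else \<one>\<^bsub>S\<^esub>) = s i"
    by (rule S.finprod_singleton) (use s i in auto)
  finally show ?thesis .
qed

text \<open>The support depends on the polynomial; sums and products can be compared once the
evaluation is summed over a common finite set of monomials.\<close>

lemma mpoly_eval_superset:
  assumes "s \<in> {..<n} \<rightarrow> carrier S" "R.carrier_coeff p" "finite B" "{m. p m \<noteq> \<zero>\<^bsub>R\<^esub>} \<subseteq> B"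
  shows "mpoly_eval s n p = (\<Oplus>\<^bsub>S\<^esub>m\<in>B. h (p m) \<otimes>\<^bsub>S\<^esub> mpoly_monomial s n m)"
  unfolding mpoly_eval_def
  by (rule S.add.finprod_mono_neutral_cong_left)
     (use assms mpoly_monomial_closed[of s n] in \<open>auto simp: R.carrier_coeff_def\<close>)

lemma mpoly_eval_closed:
  assumes "s \<in> {..<n} \<rightarrow> carrier S" "R.carrier_coeff p"
  shows "mpoly_eval s n p \<in> carrier S"
  using assms mpoly_monomial_closed[of s n] unfolding mpoly_eval_def
  by (auto simp: R.carrier_coeff_def intro!: S.finsum_closed)

lemma mpoly_eval_const:
  assumes "s \<in> {..<n} \<rightarrow> carrier S" "c \<in> carrier R"
  shows "mpoly_eval s n (R.indexed_const c) = h c"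
  using assms mpoly_monomial_closed[of s n]
  by (subst mpoly_eval_superset[where B = "{{#}}"])
     (auto simp: R.indexed_const_def R.carrier_coeff_def mpoly_monomial_empty)

lemma mpoly_eval_padd:
  assumes s: "s \<in> {..<n} \<rightarrow> carrier S"
    and p: "p \<in> R.indexed_pset {..<n} (carrier R)" and q: "q \<in> R.indexed_pset {..<n} (carrier R)"
  shows "mpoly_eval s n (R.indexed_padd p q) = mpoly_eval s n p \<oplus>\<^bsub>S\<^esub> mpoly_eval s n q"
proof -
  define B where "B = {m. p m \<noteq> \<zero>\<^bsub>R\<^esub>} \<union> {m. q m \<noteq> \<zero>\<^bsub>R\<^esub>}"
  have B: "finite B" unfolding B_def using R.finite_mpoly_support p q by blast
  have c: "R.carrier_coeff p" "R.carrier_coeff q" using R.mpoly_carrier_coeff p q by blast+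
  then have cl: "p a \<in> carrier R" "q a \<in> carrier R" for a by (auto simp: R.carrier_coeff_def)
  have m: "mpoly_monomial s n a \<in> carrier S" for a using mpoly_monomial_closed[OF s] .
  have "mpoly_eval s n (R.indexed_padd p q)
      = (\<Oplus>\<^bsub>S\<^esub>a\<in>B. h (p a \<oplus>\<^bsub>R\<^esub> q a) \<otimes>\<^bsub>S\<^esub> mpoly_monomial s n a)"
  proof -
    have "{m. R.indexed_padd p q m \<noteq> \<zero>\<^bsub>R\<^esub>} \<subseteq> B"
      by (auto simp: R.indexed_padd_def B_def)
    then show ?thesis
      using mpoly_eval_superset[OF s R.indexed_padd_in_carrier[OF c] B]
      by (simp add: R.indexed_padd_def)
  qed
  also have "\<dots> = (\<Oplus>\<^bsub>S\<^esub>a\<in>B. h (p a) \<otimes>\<^bsub>S\<^esub> mpoly_monomial s n a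
      \<oplus>\<^bsub>S\<^esub> h (q a) \<otimes>\<^bsub>S\<^esub> mpoly_monomial s n a)"
    by (rule S.finsum_cong') (use cl m in \<open>auto simp: S.l_distr\<close>)
  also have "\<dots> = mpoly_eval s n p \<oplus>\<^bsub>S\<^esub> mpoly_eval s n q"
    using cl m c
    by (subst S.finsum_addf) (auto simp: mpoly_eval_superset[OF s _ B] B_def)
  finally show ?thesis .
qed

lemma mpoly_eval_pmult:
  assumes s: "s \<in> {..<n} \<rightarrow> carrier S"
    and p: "p \<in> R.indexed_pset {..<n} (carrier R)" and i: "i < n"
  shows "mpoly_eval s n (R.indexed_pmult p i) = s i \<otimes>\<^bsub>S\<^esub> mpoly_eval s n p"
proof -
  define B where "B = {m. p m \<noteq> \<zero>\<^bsub>R\<^esub>}"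
  have B: "finite B" unfolding B_def using R.finite_mpoly_support p by blast
  have c: "R.carrier_coeff p" using R.mpoly_carrier_coeff p by blast
  then have cl: "p a \<in> carrier R" for a by (auto simp: R.carrier_coeff_def)
  have m: "mpoly_monomial s n a \<in> carrier S" for a using mpoly_monomial_closed[OF s] .
  have si: "s i \<in> carrier S" using s i by auto
  have "{m. R.indexed_pmult p i m \<noteq> \<zero>\<^bsub>R\<^esub>} = add_mset i ` B"
    unfolding B_def
    by (auto simp: R.indexed_pmult_def image_iff split: if_splits intro!: exI[of _ "_ - {#i#}"])
  then have "mpoly_eval s n (R.indexed_pmult p i)
      = (\<Oplus>\<^bsub>S\<^esub>a\<in>add_mset i ` B. h (p (a - {#i#})) \<otimes>\<^bsub>S\<^esub> mpoly_monomial s n a)"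
    unfolding mpoly_eval_def
    by (auto intro!: S.finsum_cong' simp: R.indexed_pmult_def cl m)
  also have "\<dots> = (\<Oplus>\<^bsub>S\<^esub>a\<in>B. h (p a) \<otimes>\<^bsub>S\<^esub> mpoly_monomial s n (add_mset i a))"
    by (subst S.finsum_reindex) (use cl m in \<open>auto simp: inj_on_def\<close>)
  also have "\<dots> = (\<Oplus>\<^bsub>S\<^esub>a\<in>B. s i \<otimes>\<^bsub>S\<^esub> (h (p a) \<otimes>\<^bsub>S\<^esub> mpoly_monomial s n a))"
    by (rule S.finsum_cong') (use cl m si in \<open>auto simp: mpoly_monomial_add[OF s i] S.m_lcomm\<close>)
  also have "\<dots> = s i \<otimes>\<^bsub>S\<^esub> mpoly_eval s n p"
    unfolding mpoly_eval_def B_def[symmetric]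
    by (subst S.finsum_rdistr) (use cl m si B in auto)
  finally show ?thesis .
qed

lemma mpoly_eval_var:
  assumes s: "s \<in> {..<n} \<rightarrow> carrier S" and i: "i < n"
  shows "mpoly_eval s n (R.indexed_var i) = s i"
proof -
  have "s i \<in> carrier S" using assms by auto
  then show ?thesis
    using mpoly_eval_const[OF s, of "\<one>\<^bsub>R\<^esub>"]
      mpoly_eval_pmult[OF s R.indexed_pset.indexed_const[of "\<one>\<^bsub>R\<^esub>"] i]
    by (simp add: R.indexed_var_def)
qed

text \<open>Freeness of the polynomial algebra: together with \<open>mpoly_eval_const\<close> and \<open>mpoly_eval_var\<close>, any
choice of images of the variables extends to a homomorphism over \<open>h\<close>.\<close>

lemma mpoly_eval_hom:
  assumes s: "s \<in> {..<n} \<rightarrow> carrier S"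
  shows "mpoly_eval s n \<in> ring_hom (mpoly_algebra R n) S"
proof (rule ring_hom_memI)
  fix p q
  assume "p \<in> carrier (mpoly_algebra R n)" and "q \<in> carrier (mpoly_algebra R n)"
  then have p: "p \<in> R.indexed_pset {..<n} (carrier R)" and q: "q \<in> R.indexed_pset {..<n} (carrier R)"
    by (simp_all add: R.mpoly_algebra_simps)
  have qc: "R.carrier_coeff q" by (rule R.mpoly_carrier_coeff[OF q])
  have c: "mpoly_eval s n p \<in> carrier S" if "p \<in> R.indexed_pset {..<n} (carrier R)" for p
    using mpoly_eval_closed[OF s R.mpoly_carrier_coeff[OF that]] .
  show "mpoly_eval s n p \<in> carrier S" using c p .
  show "mpoly_eval s n (p \<oplus>\<^bsub>mpoly_algebra R n\<^esub> q) = mpoly_eval s n p \<oplus>\<^bsub>S\<^esub> mpoly_eval s n q"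
    using mpoly_eval_padd[OF s p q] by (simp add: R.mpoly_algebra_simps)
  have scal: "mpoly_eval s n (\<lambda>m. b \<otimes>\<^bsub>R\<^esub> q m) = h b \<otimes>\<^bsub>S\<^esub> mpoly_eval s n q"
    if "b \<in> carrier R" for b
    using q
  proof (induction rule: R.indexed_pset.induct)
    case (indexed_const d)
    have "(\<lambda>m :: nat multiset. b \<otimes>\<^bsub>R\<^esub> R.indexed_const d m) = R.indexed_const (b \<otimes>\<^bsub>R\<^esub> d)"
      using that by (auto simp: R.indexed_const_def)
    then show ?case using that indexed_const mpoly_eval_const[OF s] by simp
  next
    case (indexed_padd p q)
    have "(\<lambda>m. b \<otimes>\<^bsub>R\<^esub> R.indexed_padd p q m)
        = R.indexed_padd (\<lambda>m. b \<otimes>\<^bsub>R\<^esub> p m) (\<lambda>m. b \<otimes>\<^bsub>R\<^esub> q m)"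
      using that indexed_padd R.mpoly_carrier_coeff[of _ "{..<n}"]
      by (auto simp: R.indexed_padd_def R.r_distr R.carrier_coeff_def)
    then show ?case
      using that indexed_padd c
      by (simp add: mpoly_eval_padd[OF s] R.mpoly_smult_closed S.r_distr)
  next
    case (indexed_pmult p i)
    have "(\<lambda>m. b \<otimes>\<^bsub>R\<^esub> R.indexed_pmult p i m) = R.indexed_pmult (\<lambda>m. b \<otimes>\<^bsub>R\<^esub> p m) i"
      using that by (auto simp: R.indexed_pmult_def)
    moreover have "s i \<in> carrier S" using indexed_pmult s by auto
    ultimately show ?case
      using that indexed_pmult c
      by (simp add: mpoly_eval_pmult[OF s] R.mpoly_smult_closed S.m_lcomm)
  qed
  have "mpoly_eval s n (mpoly_mult R p q) = mpoly_eval s n p \<otimes>\<^bsub>S\<^esub> mpoly_eval s n q"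
    using p
  proof (induction rule: R.indexed_pset.induct)
    case (indexed_const d)
    then show ?case by (simp add: R.mpoly_mult_const qc scal mpoly_eval_const[OF s])
  next
    case (indexed_padd p p')
    then show ?case
      using c q by (simp add: R.mpoly_mult_padd R.mpoly_carrier_coeff[of _ "{..<n}"] qc
        mpoly_eval_padd[OF s] R.mpoly_mult_in_pset S.l_distr)
  next
    case (indexed_pmult p i)
    moreover have "s i \<in> carrier S" using indexed_pmult s by auto
    ultimately show ?case
      using c q by (simp add: R.mpoly_mult_pmult R.mpoly_carrier_coeff[of _ "{..<n}"] qc
        mpoly_eval_pmult[OF s] R.mpoly_mult_in_pset S.m_assoc)
  qed
  then show "mpoly_eval s n (p \<otimes>\<^bsub>mpoly_algebra R n\<^esub> q)
      = mpoly_eval s n p \<otimes>\<^bsub>S\<^esub> mpoly_eval s n q"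
    by (simp add: R.mpoly_algebra_simps)
qed (use mpoly_eval_const[OF s, of "\<one>\<^bsub>R\<^esub>"] in \<open>simp add: R.mpoly_algebra_simps\<close>)

end

section \<open>Determinants over a commutative ring\<close>

context cring
begin

lemma ring_det_closed:
  assumes "\<And>i j. i < r \<Longrightarrow> j < r \<Longrightarrow> M i j \<in> carrier R"
  shows "ring_det R r M \<in> carrier R"
proof -
  have "p i < r" if "p permutes {..<r}" "i < r" for p i
    using permutes_in_image[OF that(1), of i] that by auto
  then show ?thesis
    unfolding ring_det_def using assms
    by (auto intro!: finsum_closed finprod_closed a_inv_closed)
qed

text \<open>The signed product over all rows but \<open>l\<close>. It makes the determinant visibly linear in row \<open>l\<close>.\<close>

definition row_cofactor :: "nat \<Rightarrow> (nat \<Rightarrow> nat \<Rightarrow> 'a) \<Rightarrow> nat \<Rightarrow> (nat \<Rightarrow> nat) \<Rightarrow> 'a"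
  where "row_cofactor r M l p =
    (if evenperm p then \<Otimes>i\<in>{..<r} - {l}. M i (p i) else \<ominus> (\<Otimes>i\<in>{..<r} - {l}. M i (p i)))"

lemma ring_det_row:
  assumes M: "\<And>i j. i < r \<Longrightarrow> j < r \<Longrightarrow> M i j \<in> carrier R"
    and v: "\<And>j. j < r \<Longrightarrow> v j \<in> carrier R" and l: "l < r"
  shows "ring_det R r (M(l := v)) = (\<Oplus>p\<in>{p. p permutes {..<r}}. v (p l) \<otimes> row_cofactor r M l p)"
  unfolding ring_det_def
proof (rule finsum_cong')
  have im: "p i < r" if "p permutes {..<r}" "i < r" for p i
    using permutes_in_image[OF that(1), of i] that by auto
  have cl: "(\<Otimes>i\<in>{..<r} - {l}. M i (p i)) \<in> carrier R" if "p permutes {..<r}" for p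
    using M im[OF that] by (auto intro!: finprod_closed)
  show "(\<lambda>p. v (p l) \<otimes> row_cofactor r M l p) \<in> {p. p permutes {..<r}} \<rightarrow> carrier R"
    using cl v im l by (auto simp: row_cofactor_def)
  fix p assume "p \<in> {p. p permutes {..<r}}"
  then have p: "p permutes {..<r}" by simp
  have "(\<Otimes>i\<in>{..<r}. (M(l := v)) i (p i)) = (\<Otimes>i\<in>insert l ({..<r} - {l}). (M(l := v)) i (p i))"
    using l by (simp add: insert_absorb)
  also have "\<dots> = v (p l) \<otimes> (\<Otimes>i\<in>{..<r} - {l}. (M(l := v)) i (p i))"
    using M v im[OF p] l by (subst finprod_insert) auto
  also have "(\<Otimes>i\<in>{..<r} - {l}. (M(l := v)) i (p i)) = (\<Otimes>i\<in>{..<r} - {l}. M i (p i))"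
    by (rule finprod_cong') (use M im[OF p] in auto)
  finally have eq: "(\<Otimes>i\<in>{..<r}. (M(l := v)) i (p i)) = v (p l) \<otimes> (\<Otimes>i\<in>{..<r} - {l}. M i (p i))" .
  show "(if evenperm p then \<Otimes>i\<in>{..<r}. (M(l := v)) i (p i)
      else \<ominus> (\<Otimes>i\<in>{..<r}. (M(l := v)) i (p i))) = v (p l) \<otimes> row_cofactor r M l p"
    unfolding eq row_cofactor_def using cl[OF p] v[OF im[OF p l]] by (simp add: r_minus)
qed simp

lemma ring_det_row_expand:
  assumes M: "\<And>i j. i < r \<Longrightarrow> j < r \<Longrightarrow> M i j \<in> carrier R"
    and v: "\<And>j. j < r \<Longrightarrow> v j \<in> carrier R" and l: "l < r"
  shows "ring_det R r (M(l := v))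
    = (\<Oplus>j\<in>{..<r}. v j \<otimes> ring_det R r (M(l := (\<lambda>j'. if j' = j then \<one> else \<zero>))))"
proof -
  let ?P = "{p. p permutes {..<r}}"
  let ?C = "row_cofactor r M l"
  have im: "p i < r" if "p permutes {..<r}" "i < r" for p i
    using permutes_in_image[OF that(1), of i] that by auto
  have C: "?C p \<in> carrier R" if "p \<in> ?P" for p
    using M im that by (auto simp: row_cofactor_def intro!: finprod_closed a_inv_closed)
  have fin: "finite ?P" by (rule finite_permutations) simp
  have "(\<Oplus>j\<in>{..<r}. v j \<otimes> ring_det R r (M(l := (\<lambda>j'. if j' = j then \<one> else \<zero>))))
      = (\<Oplus>j\<in>{..<r}. \<Oplus>p\<in>?P. v j \<otimes> ((if p l = j then \<one> else \<zero>) \<otimes> ?C p))"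
  proof (rule finsum_cong')
    show "(\<lambda>j. \<Oplus>p\<in>?P. v j \<otimes> ((if p l = j then \<one> else \<zero>) \<otimes> ?C p)) \<in> {..<r} \<rightarrow> carrier R"
      using v C by (auto intro!: finsum_closed)
    fix j assume "j \<in> {..<r}"
    then show "v j \<otimes> ring_det R r (M(l := (\<lambda>j'. if j' = j then \<one> else \<zero>)))
        = (\<Oplus>p\<in>?P. v j \<otimes> ((if p l = j then \<one> else \<zero>) \<otimes> ?C p))"
      using v C fin by (subst ring_det_row[OF M _ l]) (auto intro!: finsum_rdistr)
  qed simp
  also have "\<dots> = (\<Oplus>p\<in>?P. \<Oplus>j\<in>{..<r}. v j \<otimes> ((if p l = j then \<one> else \<zero>) \<otimes> ?C p))"
    by (rule finsum_finsum_swap) (use v C fin in auto)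
  also have "\<dots> = (\<Oplus>p\<in>?P. v (p l) \<otimes> ?C p)"
  proof (rule finsum_cong')
    fix p assume p: "p \<in> ?P"
    have "(\<Oplus>j\<in>{..<r}. v j \<otimes> ((if p l = j then \<one> else \<zero>) \<otimes> ?C p))
        = (\<Oplus>j\<in>{..<r}. if p l = j then v j \<otimes> ?C p else \<zero>)"
      by (rule finsum_cong') (use v C[OF p] in auto)
    also have "\<dots> = v (p l) \<otimes> ?C p"
      by (rule add.finprod_singleton) (use v C[OF p] p im l in auto)
    finally show "(\<Oplus>j\<in>{..<r}. v j \<otimes> ((if p l = j then \<one> else \<zero>) \<otimes> ?C p)) = v (p l) \<otimes> ?C p" .
  qed (use v C im l in auto)
  also have "\<dots> = ring_det R r (M(l := v))"
    by (rule ring_det_row[OF M v l, symmetric])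
  finally show ?thesis by simp
qed

text \<open>Exchanging the two equal rows pairs every even permutation with an odd one that has the
same product.\<close>

lemma ring_det_equal_rows:
  assumes M: "\<And>i j. i < r \<Longrightarrow> j < r \<Longrightarrow> M i j \<in> carrier R"
    and ab: "a < r" "b < r" "a \<noteq> b" "M a = M b"
  shows "ring_det R r M = \<zero>"
proof -
  let ?P = "{p. p permutes {..<r}}"
  let ?t = "transpose a b"
  let ?m = "\<lambda>p. \<Otimes>i\<in>{..<r}. M i (p i)"
  define E where "E = {p \<in> ?P. evenperm p}"
  define F where "F = {p \<in> ?P. \<not> evenperm p}"
  have im: "p i < r" if "p permutes {..<r}" "i < r" for p i
    using permutes_in_image[OF that(1), of i] that by auto
  have m: "?m p \<in> carrier R" if "p permutes {..<r}" for p
    using M im[OF that] by (auto intro!: finprod_closed)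
  have finP: "finite ?P" by (rule finite_permutations) simp
  then have fin: "finite E" "finite F" by (auto simp: E_def F_def)
  have t: "?t permutes {..<r}" using ab by (intro permutes_swap_id) auto
  have flip: "evenperm (p \<circ> ?t) \<longleftrightarrow> \<not> evenperm p" if "p permutes {..<r}" for p
    using that ab permutation_permutes[of p]
    by (subst evenperm_comp) (auto simp: permutation_swap_id evenperm_swap intro: exI[of _ "{..<r}"])
  have img: "F = (\<lambda>p. p \<circ> ?t) ` E"
  proof (intro equalityI subsetI)
    fix p assume p: "p \<in> F"
    then have "p \<circ> ?t \<in> E"
      using flip[of p] permutes_compose[OF t, of p] by (simp add: E_def F_def)
    moreover have "p = (p \<circ> ?t) \<circ> ?t" by (simp add: fun_eq_iff)
    ultimately show "p \<in> (\<lambda>p. p \<circ> ?t) ` E" by (metis image_eqI)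
  next
    fix p assume "p \<in> (\<lambda>p. p \<circ> ?t) ` E"
    then show "p \<in> F"
      using flip permutes_compose[OF t] by (auto simp: E_def F_def)
  qed
  have inj: "inj_on (\<lambda>p. p \<circ> ?t) E"
    by (rule inj_onI) (metis comp_assoc comp_id transpose_comp_involutory)
  have same: "?m (p \<circ> ?t) = ?m p" if p: "p permutes {..<r}" for p
  proof -
    have "?m p = (\<Otimes>i\<in>?t ` {..<r}. M i (p i))" using permutes_image[OF t] by simp
    also have "\<dots> = (\<Otimes>i\<in>{..<r}. M (?t i) (p (?t i)))"
      by (rule finprod_reindex)
         (use M im[OF p] im[OF t] in \<open>auto simp: permutes_inj_on[OF t]\<close>)
    also have "\<dots> = ?m (p \<circ> ?t)"
    proof (rule finprod_cong')
      show "(\<lambda>i. M i ((p \<circ> ?t) i)) \<in> {..<r} \<rightarrow> carrier R"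
        using M im[OF p] im[OF t] by auto
      show "M (?t i) (p (?t i)) = M i ((p \<circ> ?t) i)" for i
        using ab by (cases "i = a"; cases "i = b") auto
    qed simp
    finally show ?thesis by simp
  qed
  have P: "?P = E \<union> F" "E \<inter> F = {}" by (auto simp: E_def F_def)
  have "ring_det R r M = (\<Oplus>p\<in>E. ?m p) \<oplus> (\<Oplus>p\<in>F. \<ominus> ?m p)"
    unfolding ring_det_def P(1)
    by (subst finsum_Un_disjoint[OF fin P(2)])
       (use m in \<open>auto simp: E_def F_def intro!: arg_cong2[of _ _ _ _ "(\<oplus>)"] finsum_cong'\<close>)
  also have "(\<Oplus>p\<in>F. \<ominus> ?m p) = (\<Oplus>p\<in>E. \<ominus> ?m (p \<circ> ?t))"
    unfolding img
    by (rule finsum_reindex) (use inj m permutes_compose[OF t] in \<open>auto simp: E_def\<close>)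
  also have "\<dots> = (\<Oplus>p\<in>E. \<ominus> ?m p)"
    by (rule finsum_cong') (use same m in \<open>auto simp: E_def\<close>)
  also have "(\<Oplus>p\<in>E. ?m p) \<oplus> (\<Oplus>p\<in>E. \<ominus> ?m p) = (\<Oplus>p\<in>E. ?m p \<oplus> \<ominus> ?m p)"
    by (rule finsum_addf[symmetric]) (use m in \<open>auto simp: E_def\<close>)
  also have "\<dots> = \<zero>"
    by (rule add.finprod_one_eqI) (use m in \<open>auto simp: E_def r_neg\<close>)
  finally show ?thesis .
qed

text \<open>The adjugate has as entry \<open>(j, l)\<close> the determinant with row \<open>l\<close> replaced by the \<open>j\<close>-th unit
vector. Expanding along row \<open>l\<close>, the product of row \<open>i\<close> with column \<open>l\<close> of the adjugate is the
determinant with row \<open>l\<close> replaced by row \<open>i\<close>.\<close>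

lemma ring_det_adjugate:
  assumes M: "\<And>i j. i < r \<Longrightarrow> j < r \<Longrightarrow> M i j \<in> carrier R"
  obtains N where "\<And>j l. j < r \<Longrightarrow> l < r \<Longrightarrow> N j l \<in> carrier R"
    and "\<And>i l. i < r \<Longrightarrow> l < r \<Longrightarrow>
      (\<Oplus>j\<in>{..<r}. M i j \<otimes> N j l) = (if i = l then ring_det R r M else \<zero>)"
proof -
  let ?N = "\<lambda>j l. ring_det R r (M(l := (\<lambda>j'. if j' = j then \<one> else \<zero>)))"
  have closed: "?N j l \<in> carrier R" if "j < r" "l < r" for j l
    by (rule ring_det_closed) (use M in auto)
  have "(\<Oplus>j\<in>{..<r}. M i j \<otimes> ?N j l) = (if i = l then ring_det R r M else \<zero>)"
    if "i < r" "l < r" for i l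
  proof -
    have "(\<Oplus>j\<in>{..<r}. M i j \<otimes> ?N j l) = ring_det R r (M(l := M i))"
      by (rule ring_det_row_expand[symmetric]) (use M that in auto)
    moreover have "ring_det R r (M(l := M i)) = \<zero>" if "i \<noteq> l"
      by (rule ring_det_equal_rows[where a = i and b = l]) (use M that \<open>i < r\<close> \<open>l < r\<close> in auto)
    ultimately show ?thesis by auto
  qed
  with closed show ?thesis by (rule that)
qed

end

lemma (in ring_hom_cring) hom_ring_det:
  assumes M: "\<And>i j. i < r \<Longrightarrow> j < r \<Longrightarrow> M i j \<in> carrier R"
  shows "h (ring_det R r M) = ring_det S r (\<lambda>i j. h (M i j))"
proof -
  have im: "p i < r" if "p permutes {..<r}" "i < r" for p i
    using permutes_in_image[OF that(1), of i] that by auto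
  have m: "(\<Otimes>\<^bsub>R\<^esub>i\<in>{..<r}. M i (p i)) \<in> carrier R" if "p permutes {..<r}" for p
    using M im[OF that] by (auto intro!: R.finprod_closed)
  have h: "h (\<Otimes>\<^bsub>R\<^esub>i\<in>{..<r}. M i (p i)) = (\<Otimes>\<^bsub>S\<^esub>i\<in>{..<r}. h (M i (p i)))" 
    if "p permutes {..<r}" for p
    by (subst hom_finprod) (use M im[OF that] in \<open>auto simp: comp_def\<close>)
  have hm: "(\<Otimes>\<^bsub>S\<^esub>i\<in>{..<r}. h (M i (p i))) \<in> carrier S" if "p permutes {..<r}" for p
    using M im[OF that] by (auto intro!: S.finprod_closed)
  show ?thesis
    unfolding ring_det_def
    by (subst hom_finsum) (use m h hm in \<open>auto simp: comp_def intro!: S.finsum_cong'\<close>)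
qed

section \<open>Linear systems with right-hand sides in the square of the ideal of minors\<close>

context cring
begin

text \<open>In a commutative ring negatives come for free, as multiples by \<open>-1\<close>, and one-sided absorption is
enough.\<close>

lemma idealI_lmult:
  assumes "K \<subseteq> carrier R" "\<zero> \<in> K" "\<And>a b. a \<in> K \<Longrightarrow> b \<in> K \<Longrightarrow> a \<oplus> b \<in> K"
    and mult: "\<And>a x. a \<in> K \<Longrightarrow> x \<in> carrier R \<Longrightarrow> x \<otimes> a \<in> K"
  shows "ideal K R"
proof (rule idealI[OF ring_axioms])
  show "subgroup K (add_monoid R)"
  proof
    show "inv\<^bsub>add_monoid R\<^esub> x \<in> K" if "x \<in> K" for x
    proof -
      have "\<ominus> x = \<ominus> \<one> \<otimes> x" using that assms(1) by (auto simp: l_minus)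
      then have "\<ominus> x \<in> K" using mult[OF that, of "\<ominus> \<one>"] by simp
      then show ?thesis by (simp add: a_inv_def)
    qed
  qed (use assms in auto)
  show "a \<otimes> x \<in> K" if "a \<in> K" "x \<in> carrier R" for a x
  proof -
    have "a \<in> carrier R" using that(1) assms(1) by auto
    then show ?thesis using mult[OF that] that m_comm[of a x] by simp
  qed
qed (rule mult)

lemma finsum_in_ideal:
  assumes "ideal J R" "\<And>x. x \<in> B \<Longrightarrow> g x \<in> J"
  shows "(\<Oplus>x\<in>B. g x) \<in> J"
proof -
  interpret J: ideal J R by fact
  show ?thesis
    using assms(2)
  proof (induction B rule: infinite_finite_induct)
    case (insert x B)
    then show ?case by (subst finsum_insert) (auto intro!: J.Icarr)
  qed simp_all
qed

text \<open>A maximal minor times a unit vector is hit by the adjugate of its square submatrix, with the unused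
columns given coefficient zero. As \<open>\<rho>\<close> selects all the rows, every equation of the system is under
control.\<close>

lemma minor_solves:
  fixes M :: "nat \<Rightarrow> nat \<Rightarrow> 'a"
  assumes M: "\<And>i j. i < r \<Longrightarrow> j < n \<Longrightarrow> M i j \<in> carrier R"
    and \<rho>: "inj_on \<rho> {..<r}" "\<rho> ` {..<r} \<subseteq> {..<r}"
    and \<gamma>: "inj_on \<gamma> {..<r}" "\<gamma> ` {..<r} \<subseteq> {..<n}"
    and J: "ideal J R" and u: "u \<in> J" and l: "l < r"
  shows "\<exists>w\<in>{..<n} \<rightarrow> J. \<forall>i<r. (\<Oplus>j\<in>{..<n}. M i j \<otimes> w j)
    = (if i = l then ring_det R r (\<lambda>i j. M (\<rho> i) (\<gamma> j)) \<otimes> u else \<zero>)"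
proof -
  interpret J: ideal J R by fact
  let ?M = "\<lambda>i j. M (\<rho> i) (\<gamma> j)"
  let ?D = "ring_det R r ?M"
  have M': "?M i j \<in> carrier R" if "i < r" "j < r" for i j
    using that \<rho>(2) \<gamma>(2) by (auto simp: image_subset_iff intro!: M)
  have D: "?D \<in> carrier R" by (rule ring_det_closed) (rule M')
  have uc: "u \<in> carrier R" using u by (rule J.Icarr)
  have \<rho>': "\<rho> ` {..<r} = {..<r}" using \<rho> by (intro endo_inj_surj) auto
  obtain N where N: "\<And>j l. j < r \<Longrightarrow> l < r \<Longrightarrow> N j l \<in> carrier R"
    "\<And>i l. i < r \<Longrightarrow> l < r \<Longrightarrow> (\<Oplus>j\<in>{..<r}. ?M i j \<otimes> N j l) = (if i = l then ?D else \<zero>)"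
    using ring_det_adjugate[of r ?M] M' by blast
  obtain l' where l': "l' < r" "l = \<rho> l'" using l \<rho>' by (metis imageE lessThan_iff)
  define w where "w c = (if c \<in> \<gamma> ` {..<r} then N (inv_into {..<r} \<gamma> c) l' \<otimes> u else \<zero>)" for c
  have w\<gamma>: "w (\<gamma> j) = N j l' \<otimes> u" if "j < r" for j
    using that \<gamma>(1) by (simp add: w_def)
  have w0: "w c = \<zero>" if "c \<notin> \<gamma> ` {..<r}" for c
    using that by (simp add: w_def)
  have wJ: "w c \<in> J" for c
    using N(1) l' u inv_into_into[of c \<gamma> "{..<r}"]
    by (auto simp: w_def intro!: J.I_l_closed J.zero_closed)
  have wc: "w c \<in> carrier R" for c using wJ by (rule J.Icarr)
  have "(\<Oplus>j\<in>{..<n}. M i j \<otimes> w j) = (if i = l then ?D \<otimes> u else \<zero>)" if i: "i < r" for i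
  proof -
    obtain i' where i': "i' < r" "i = \<rho> i'" using i \<rho>' by (metis imageE lessThan_iff)
    have "(\<Oplus>j\<in>{..<n}. M i j \<otimes> w j) = (\<Oplus>j\<in>\<gamma> ` {..<r}. M i j \<otimes> w j)"
      by (rule add.finprod_mono_neutral_cong_right)
         (use \<gamma>(2) M[OF i] wc w0 in auto)
    also have "\<dots> = (\<Oplus>j\<in>{..<r}. M i (\<gamma> j) \<otimes> w (\<gamma> j))"
      by (rule finsum_reindex) (use \<gamma> M i wc in auto)
    also have "\<dots> = (\<Oplus>j\<in>{..<r}. (?M i' j \<otimes> N j l') \<otimes> u)"
      by (rule finsum_cong') (use M' N(1) i' l' uc in \<open>auto simp: w\<gamma> m_assoc\<close>)
    also have "\<dots> = (\<Oplus>j\<in>{..<r}. ?M i' j \<otimes> N j l') \<otimes> u"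
      by (rule finsum_ldistr[symmetric]) (use M' N(1) i' l' uc in auto)
    also have "\<dots> = (if i = l then ?D \<otimes> u else \<zero>)"
      using N(2)[of i' l'] i' l' uc \<rho>(1) by (auto simp: inj_on_eq_iff)
    finally show ?thesis .
  qed
  with wJ show ?thesis by blast
qed

text \<open>For a fixed equation \<open>l\<close>, the values \<open>u\<close> for which \<open>u\<close> times the \<open>l\<close>-th unit vector is reached by a
solution in \<open>J\<close> form an ideal. It contains \<open>d b\<close> for each minor \<open>d\<close> and each \<open>b \<in> J\<close>, hence all of
\<open>J\<^sup>2\<close>; the general right-hand side is the sum of its components.\<close>

lemma linear_system_solvable:
  fixes M :: "nat \<Rightarrow> nat \<Rightarrow> 'a"
  assumes M: "\<And>i j. i < r \<Longrightarrow> j < n \<Longrightarrow> M i j \<in> carrier R"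
    and Jdef: "J = Idl \<Delta>"
    and \<Delta>: "\<And>d. d \<in> \<Delta> \<Longrightarrow> \<exists>\<rho> \<gamma>. d = ring_det R r (\<lambda>i j. M (\<rho> i) (\<gamma> j))
        \<and> inj_on \<rho> {..<r} \<and> \<rho> ` {..<r} \<subseteq> {..<r} \<and> inj_on \<gamma> {..<r} \<and> \<gamma> ` {..<r} \<subseteq> {..<n}"
    and z: "\<And>i. i < r \<Longrightarrow> z i \<in> J \<cdot> J"
  shows "\<exists>w\<in>{..<n} \<rightarrow> J. \<forall>i<r. (\<Oplus>j\<in>{..<n}. M i j \<otimes> w j) = z i"
proof -
  have \<Delta>c: "\<Delta> \<subseteq> carrier R"
  proof
    fix d assume "d \<in> \<Delta>"
    with \<Delta>[of d] show "d \<in> carrier R"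
      by (auto intro!: ring_det_closed M simp: image_subset_iff)
  qed
  interpret J: ideal J R unfolding Jdef by (rule genideal_ideal[OF \<Delta>c])
  have JJ: "J \<cdot> J \<subseteq> carrier R" by (rule ideal_prod_in_carrier) (rule J.ideal_axioms)+
  define U where "U l = {u \<in> carrier R. \<exists>w\<in>{..<n} \<rightarrow> J. \<forall>i<r.
    (\<Oplus>j\<in>{..<n}. M i j \<otimes> w j) = (if i = l then u else \<zero>)}" for l
  have UI: "u \<in> U l" if "u \<in> carrier R" "w \<in> {..<n} \<rightarrow> J"
    "\<And>i. i < r \<Longrightarrow> (\<Oplus>j\<in>{..<n}. M i j \<otimes> w j) = (if i = l then u else \<zero>)" for u l w
    unfolding U_def using that by blast
  have Uadd: "a \<oplus> b \<in> U l" if ab: "a \<in> U l" "b \<in> U l" for a b l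
  proof -
    from ab have c: "a \<in> carrier R" "b \<in> carrier R" by (auto simp: U_def)
    obtain v w where v: "v \<in> {..<n} \<rightarrow> J"
      "\<And>i. i < r \<Longrightarrow> (\<Oplus>j\<in>{..<n}. M i j \<otimes> v j) = (if i = l then a else \<zero>)"
      and w: "w \<in> {..<n} \<rightarrow> J"
      "\<And>i. i < r \<Longrightarrow> (\<Oplus>j\<in>{..<n}. M i j \<otimes> w j) = (if i = l then b else \<zero>)"
      using ab unfolding U_def by blast
    have vc: "v j \<in> carrier R" "w j \<in> carrier R" if "j < n" for j
      using v(1) w(1) that by (simp_all add: Pi_iff J.Icarr)
    have "(\<Oplus>j\<in>{..<n}. M i j \<otimes> (v j \<oplus> w j)) = (if i = l then a \<oplus> b else \<zero>)" if "i < r" for i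
    proof -
      have "(\<Oplus>j\<in>{..<n}. M i j \<otimes> (v j \<oplus> w j)) = (\<Oplus>j\<in>{..<n}. M i j \<otimes> v j \<oplus> M i j \<otimes> w j)"
        by (rule finsum_cong') (use M vc that in \<open>auto simp: r_distr\<close>)
      also have "\<dots> = (\<Oplus>j\<in>{..<n}. M i j \<otimes> v j) \<oplus> (\<Oplus>j\<in>{..<n}. M i j \<otimes> w j)"
        by (rule finsum_addf) (use M vc that in auto)
      finally show ?thesis using v(2) w(2) that by auto
    qed
    moreover have "(\<lambda>j. v j \<oplus> w j) \<in> {..<n} \<rightarrow> J" using v(1) w(1) by auto
    ultimately show ?thesis using c by (intro UI[of "a \<oplus> b" "\<lambda>j. v j \<oplus> w j"]) auto
  qed
  have Umult: "c \<otimes> a \<in> U l" if a: "a \<in> U l" and c: "c \<in> carrier R" for a c l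
  proof -
    from a have ac: "a \<in> carrier R" by (auto simp: U_def)
    obtain v where v: "v \<in> {..<n} \<rightarrow> J"
      "\<And>i. i < r \<Longrightarrow> (\<Oplus>j\<in>{..<n}. M i j \<otimes> v j) = (if i = l then a else \<zero>)"
      using a unfolding U_def by blast
    have vc: "v j \<in> carrier R" if "j < n" for j
      using v(1) that by (simp add: Pi_iff J.Icarr)
    have "(\<Oplus>j\<in>{..<n}. M i j \<otimes> (c \<otimes> v j)) = (if i = l then c \<otimes> a else \<zero>)" if "i < r" for i
    proof -
      have "(\<Oplus>j\<in>{..<n}. M i j \<otimes> (c \<otimes> v j)) = (\<Oplus>j\<in>{..<n}. c \<otimes> (M i j \<otimes> v j))"
        by (rule finsum_cong') (use M vc c that in \<open>auto simp: m_lcomm\<close>)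
      also have "\<dots> = c \<otimes> (\<Oplus>j\<in>{..<n}. M i j \<otimes> v j)"
        by (rule finsum_rdistr[symmetric]) (use M vc c that in auto)
      finally show ?thesis using v(2) that c by auto
    qed
    moreover have "(\<lambda>j. c \<otimes> v j) \<in> {..<n} \<rightarrow> J" using v(1) c J.I_l_closed by auto
    ultimately show ?thesis using c ac by (intro UI[of "c \<otimes> a" "\<lambda>j. c \<otimes> v j"]) auto
  qed
  have Uprod: "a \<otimes> b \<in> U l" if a: "a \<in> J" and b: "b \<in> J" and l: "l < r" for a b l
  proof -
    \<comment> \<open>The set of those \<open>a\<close> that work against every \<open>b \<in> J\<close> is an ideal containing the minors.\<close>
    define K where "K = {a \<in> carrier R. \<forall>b\<in>J. a \<otimes> b \<in> U l}"
    have "ideal K R"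
    proof (rule idealI_lmult)
      show "K \<subseteq> carrier R" by (auto simp: K_def)
      show "\<zero> \<in> K"
        unfolding K_def using M
        by (auto intro!: UI[of _ "\<lambda>_. \<zero>"] add.finprod_one_eqI J.zero_closed simp: J.Icarr)
      show "a \<oplus> b \<in> K" if "a \<in> K" "b \<in> K" for a b
        using that Uadd unfolding K_def by (auto simp: l_distr J.Icarr)
      show "x \<otimes> a \<in> K" if "a \<in> K" "x \<in> carrier R" for a x
        using that Umult unfolding K_def by (auto simp: m_assoc J.Icarr)
    qed
    moreover have "\<Delta> \<subseteq> K"
    proof
      fix d assume d: "d \<in> \<Delta>"
      then obtain \<rho> \<gamma> where d': "d = ring_det R r (\<lambda>i j. M (\<rho> i) (\<gamma> j))"
        "inj_on \<rho> {..<r}" "\<rho> ` {..<r} \<subseteq> {..<r}" "inj_on \<gamma> {..<r}" "\<gamma> ` {..<r} \<subseteq> {..<n}"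
        using \<Delta> by blast
      have "\<exists>w\<in>{..<n} \<rightarrow> J. \<forall>i<r. (\<Oplus>j\<in>{..<n}. M i j \<otimes> w j)
          = (if i = l then d \<otimes> b else \<zero>)" if "b \<in> J" for b
        unfolding d'(1) by (rule minor_solves[OF M d'(2-5) J.ideal_axioms that l])
      moreover have "d \<in> carrier R" using d \<Delta>c by auto
      ultimately show "d \<in> K" unfolding K_def U_def by (simp add: J.Icarr)
    qed
    ultimately have "J \<subseteq> K" unfolding Jdef by (rule genideal_minimal)
    with a b show ?thesis by (auto simp: K_def)
  qed
  have U: "u \<in> U l" if "u \<in> J \<cdot> J" "l < r" for u l
    using that(1) by (induction rule: ideal_prod.induct) (use Uprod[OF _ _ that(2)] Uadd in auto)
  have "\<forall>l<r. \<exists>w\<in>{..<n} \<rightarrow> J. \<forall>i<r.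
      (\<Oplus>j\<in>{..<n}. M i j \<otimes> w j) = (if i = l then z l else \<zero>)"
    using U z unfolding U_def by blast
  then obtain W where W: "\<And>l. l < r \<Longrightarrow> W l \<in> {..<n} \<rightarrow> J"
    "\<And>l i. l < r \<Longrightarrow> i < r \<Longrightarrow>
      (\<Oplus>j\<in>{..<n}. M i j \<otimes> W l j) = (if i = l then z l else \<zero>)"
    by metis
  have Wc: "W l j \<in> carrier R" if "l < r" "j < n" for l j
    using W(1)[OF that(1)] that(2) by (simp add: Pi_iff J.Icarr)
  define w where "w j = (\<Oplus>l\<in>{..<r}. W l j)" for j
  have wJ: "w \<in> {..<n} \<rightarrow> J"
    using W(1) by (auto simp: w_def Pi_iff intro!: finsum_in_ideal[OF J.ideal_axioms])
  have "(\<Oplus>j\<in>{..<n}. M i j \<otimes> w j) = z i" if i: "i < r" for i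
  proof -
    have zc: "z l \<in> carrier R" if "l < r" for l using z[OF that] JJ by auto
    have "(\<Oplus>j\<in>{..<n}. M i j \<otimes> w j) = (\<Oplus>j\<in>{..<n}. \<Oplus>l\<in>{..<r}. M i j \<otimes> W l j)"
      by (rule finsum_cong') (use M Wc i in \<open>auto simp: w_def intro!: finsum_rdistr finsum_closed\<close>)
    also have "\<dots> = (\<Oplus>l\<in>{..<r}. \<Oplus>j\<in>{..<n}. M i j \<otimes> W l j)"
      by (rule finsum_finsum_swap) (use M Wc i in auto)
    also have "\<dots> = (\<Oplus>l\<in>{..<r}. if i = l then z l else \<zero>)"
      by (rule finsum_cong') (use W(2) i zc in auto)
    also have "\<dots> = z i"
      by (rule add.finprod_singleton) (use i zc in auto)
    finally show ?thesis .
  qed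
  with wJ show ?thesis by blast
qed

end

section \<open>Quotient algebras\<close>

lemma FactAlgebra_simps:
  "carrier (FactAlgebra R I) = carrier (R Quot I)"
  "x \<otimes>\<^bsub>FactAlgebra R I\<^esub> y = x \<otimes>\<^bsub>R Quot I\<^esub> y"
  "\<one>\<^bsub>FactAlgebra R I\<^esub> = \<one>\<^bsub>R Quot I\<^esub>"
  "\<zero>\<^bsub>FactAlgebra R I\<^esub> = \<zero>\<^bsub>R Quot I\<^esub>"
  "x \<oplus>\<^bsub>FactAlgebra R I\<^esub> y = x \<oplus>\<^bsub>R Quot I\<^esub> y"
  "c \<odot>\<^bsub>FactAlgebra R I\<^esub> C = (\<Union>x\<in>C. I +>\<^bsub>R\<^esub> (c \<odot>\<^bsub>R\<^esub> x))"
  by (simp_all add: FactAlgebra_def ring.defs module.defs)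

text \<open>The algebra and the quotient ring have the same operations but different record types, so the
axioms are transferred one by one.\<close>

lemma FactAlgebra_cring:
  assumes "cring R" "ideal I R"
  shows "cring (FactAlgebra R I)"
proof -
  interpret Q: cring "R Quot I" using ideal.quotient_is_cring[OF assms(2,1)] .
  show ?thesis
  proof (rule cringI)
    show "abelian_group (FactAlgebra R I)"
    proof (rule abelian_groupI)
      fix x assume "x \<in> carrier (FactAlgebra R I)"
      then show "\<exists>y\<in>carrier (FactAlgebra R I).
          y \<oplus>\<^bsub>FactAlgebra R I\<^esub> x = \<zero>\<^bsub>FactAlgebra R I\<^esub>"
        by (intro bexI[of _ "\<ominus>\<^bsub>R Quot I\<^esub> x"]) (auto simp: FactAlgebra_simps Q.l_neg)
    qed (simp_all add: FactAlgebra_simps Q.a_ac)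
    show "comm_monoid (FactAlgebra R I)"
      by (rule comm_monoidI)
        (simp_all add: FactAlgebra_simps Q.m_assoc, simp add: Q.m_comm)
  qed (simp add: FactAlgebra_simps Q.l_distr)
qed

lemma FactAlgebra_proj_hom:
  assumes "cring R" "ideal I R"
  shows "ring_hom_cring R (FactAlgebra R I) ((+>\<^bsub>R\<^esub>) I)"
proof (rule ring_hom_cringI[OF assms(1) FactAlgebra_cring[OF assms]])
  show "(+>\<^bsub>R\<^esub>) I \<in> ring_hom R (FactAlgebra R I)"
    using ideal.rcos_ring_hom[OF assms(2)] by (simp add: ring_hom_def FactAlgebra_simps)
qed

lemma FactAlgebra_proj_surj: "carrier (FactAlgebra R I) = (+>\<^bsub>R\<^esub>) I ` carrier R"
  by (auto simp: FactAlgebra_simps FactRing_simps)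

lemma FactAlgebra_proj_kernel:
  assumes "cring R" "ideal I R" "x \<in> carrier R" "y \<in> carrier R"
  shows "I +>\<^bsub>R\<^esub> x = I +>\<^bsub>R\<^esub> y \<longleftrightarrow> x \<ominus>\<^bsub>R\<^esub> y \<in> I"
  using ring.quotient_eq_iff_same_a_r_cos[of R I x y] assms cring.axioms(1) by blast

section \<open>Sequences of maps satisfying the higher Leibniz rule\<close>

text \<open>The Leibniz rule of order \<open>\<alpha>\<close> for maps between possibly different rings. For \<open>R = A\<close> it is the condition
in the definition of Hasse-Schmidt derivations; for a polynomial ring \<open>R\<close> over \<open>A\<close> it says that
\<open>p \<mapsto> \<Sum> E\<^sub>i(p) t\<^sup>i\<close> is multiplicative up to the coefficient of \<open>t\<^sup>\<alpha>\<close>.\<close>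

definition leibniz_rule ::
    "('b, 'm) ring_scheme \<Rightarrow> ('c, 'n) ring_scheme \<Rightarrow> (nat \<Rightarrow> 'b \<Rightarrow> 'c) \<Rightarrow> nat \<Rightarrow> bool"
  where "leibniz_rule R A E \<alpha> \<longleftrightarrow> (\<forall>p\<in>carrier R. \<forall>q\<in>carrier R.
    E \<alpha> (p \<otimes>\<^bsub>R\<^esub> q) = (\<Oplus>\<^bsub>A\<^esub>i\<in>{..\<alpha>}. E i p \<otimes>\<^bsub>A\<^esub> E (\<alpha> - i) q))"

lemma leibniz_ruleD:
  "\<lbrakk>leibniz_rule R A E \<alpha>; p \<in> carrier R; q \<in> carrier R\<rbrakk>
    \<Longrightarrow> E \<alpha> (p \<otimes>\<^bsub>R\<^esub> q) = (\<Oplus>\<^bsub>A\<^esub>i\<in>{..\<alpha>}. E i p \<otimes>\<^bsub>A\<^esub> E (\<alpha> - i) q)"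
  by (simp add: leibniz_rule_def)

context cring
begin

lemma finsum_atMost_ends:
  fixes N :: nat
  assumes "0 < N" "\<And>i. i \<le> N \<Longrightarrow> g i \<in> carrier R"
  shows "(\<Oplus>i\<in>{..N}. g i) = g 0 \<oplus> (g N \<oplus> (\<Oplus>i\<in>{0<..<N}. g i))"
proof -
  have "{..N} = insert 0 (insert N {0<..<N})" using assms(1) by auto
  then show ?thesis
    using assms by (simp add: finsum_insert Pi_iff)
qed

text \<open>Applied to \<open>1 = 1 \<cdot> 1\<close>, the rule reads \<open>D\<^sub>\<alpha>(1) = 2 D\<^sub>\<alpha>(1)\<close> once the intermediate terms
vanish by induction.\<close>

lemma leibniz_rule_one:
  assumes cl: "\<And>i. i < N \<Longrightarrow> D i \<one> \<in> carrier R" and D0: "D 0 \<one> = \<one>"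
    and L: "\<And>i. i < N \<Longrightarrow> leibniz_rule R R D i"
  shows "\<lbrakk>0 < \<alpha>; \<alpha> < N\<rbrakk> \<Longrightarrow> D \<alpha> \<one> = \<zero>"
proof (induction \<alpha> rule: less_induct)
  case (less \<alpha>)
  have c: "D i \<one> \<in> carrier R" if "i \<le> \<alpha>" for i using cl that less.prems by simp
  have "D \<alpha> \<one> = (\<Oplus>i\<in>{..\<alpha>}. D i \<one> \<otimes> D (\<alpha> - i) \<one>)"
    using leibniz_ruleD[OF L[OF less.prems(2)], of \<one> \<one>] by simp
  also have "\<dots> = D \<alpha> \<one> \<oplus> (D \<alpha> \<one> \<oplus> (\<Oplus>i\<in>{0<..<\<alpha>}. D i \<one> \<otimes> D (\<alpha> - i) \<one>))"
    using less.prems c by (subst finsum_atMost_ends) (auto simp: D0)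
  also have "(\<Oplus>i\<in>{0<..<\<alpha>}. D i \<one> \<otimes> D (\<alpha> - i) \<one>) = \<zero>"
    by (rule add.finprod_one_eqI) (use less.IH less.prems c in auto)
  finally show ?case
    using c[of \<alpha>] by (simp add: add.l_cancel_one')
qed

end

text \<open>A linear combination of derivations of \<open>R\<close>, with coefficients \<open>w\<close> in \<open>S\<close>, is a derivation from \<open>R\<close>
to \<open>S\<close> along \<open>h\<close>.\<close>

lemma (in ring_hom_cring) finsum_derivations:
  assumes w: "w \<in> B \<rightarrow> carrier S" and B: "finite B"
    and d: "\<And>j p. j \<in> B \<Longrightarrow> p \<in> carrier R \<Longrightarrow> d j p \<in> carrier R"
    and dmult: "\<And>j p q. \<lbrakk>j \<in> B; p \<in> carrier R; q \<in> carrier R\<rbrakk>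
      \<Longrightarrow> d j (p \<otimes>\<^bsub>R\<^esub> q) = (d j p \<otimes>\<^bsub>R\<^esub> q) \<oplus>\<^bsub>R\<^esub> (p \<otimes>\<^bsub>R\<^esub> d j q)"
    and pq: "p \<in> carrier R" "q \<in> carrier R"
  shows "(\<Oplus>\<^bsub>S\<^esub>j\<in>B. h (d j (p \<otimes>\<^bsub>R\<^esub> q)) \<otimes>\<^bsub>S\<^esub> w j)
    = (h p \<otimes>\<^bsub>S\<^esub> (\<Oplus>\<^bsub>S\<^esub>j\<in>B. h (d j q) \<otimes>\<^bsub>S\<^esub> w j)) \<oplus>\<^bsub>S\<^esub> ((\<Oplus>\<^bsub>S\<^esub>j\<in>B. h (d j p) \<otimes>\<^bsub>S\<^esub> w j) \<otimes>\<^bsub>S\<^esub> h q)"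
proof -
  have wc: "w j \<in> carrier S" if "j \<in> B" for j using w that by auto
  have hc: "h (d j p) \<in> carrier S" if "p \<in> carrier R" "j \<in> B" for j p using d that by simp
  have "(\<Oplus>\<^bsub>S\<^esub>j\<in>B. h (d j (p \<otimes>\<^bsub>R\<^esub> q)) \<otimes>\<^bsub>S\<^esub> w j)
    = (\<Oplus>\<^bsub>S\<^esub>j\<in>B. (h p \<otimes>\<^bsub>S\<^esub> (h (d j q) \<otimes>\<^bsub>S\<^esub> w j)) \<oplus>\<^bsub>S\<^esub> ((h (d j p) \<otimes>\<^bsub>S\<^esub> w j) \<otimes>\<^bsub>S\<^esub> h q))"
  proof (rule S.finsum_cong')
    fix j assume j: "j \<in> B"
    have "(b \<otimes>\<^bsub>S\<^esub> c \<oplus>\<^bsub>S\<^esub> a \<otimes>\<^bsub>S\<^esub> e) \<otimes>\<^bsub>S\<^esub> u = (a \<otimes>\<^bsub>S\<^esub> (e \<otimes>\<^bsub>S\<^esub> u)) \<oplus>\<^bsub>S\<^esub> ((b \<otimes>\<^bsub>S\<^esub> u) \<otimes>\<^bsub>S\<^esub> c)"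
      if "a \<in> carrier S" "b \<in> carrier S" "c \<in> carrier S" "e \<in> carrier S" "u \<in> carrier S"
      for a b c e u
      using that by algebra
    then show "h (d j (p \<otimes>\<^bsub>R\<^esub> q)) \<otimes>\<^bsub>S\<^esub> w j
      = (h p \<otimes>\<^bsub>S\<^esub> (h (d j q) \<otimes>\<^bsub>S\<^esub> w j)) \<oplus>\<^bsub>S\<^esub> ((h (d j p) \<otimes>\<^bsub>S\<^esub> w j) \<otimes>\<^bsub>S\<^esub> h q)"
      using j pq d wc by (simp add: dmult)
  qed (use pq wc hc in auto)
  also have "\<dots> = (\<Oplus>\<^bsub>S\<^esub>j\<in>B. h p \<otimes>\<^bsub>S\<^esub> (h (d j q) \<otimes>\<^bsub>S\<^esub> w j))
      \<oplus>\<^bsub>S\<^esub> (\<Oplus>\<^bsub>S\<^esub>j\<in>B. (h (d j p) \<otimes>\<^bsub>S\<^esub> w j) \<otimes>\<^bsub>S\<^esub> h q)"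
    by (rule S.finsum_addf) (use pq wc hc in auto)
  also have "(\<Oplus>\<^bsub>S\<^esub>j\<in>B. h p \<otimes>\<^bsub>S\<^esub> (h (d j q) \<otimes>\<^bsub>S\<^esub> w j))
      = h p \<otimes>\<^bsub>S\<^esub> (\<Oplus>\<^bsub>S\<^esub>j\<in>B. h (d j q) \<otimes>\<^bsub>S\<^esub> w j)"
    by (rule S.finsum_rdistr[symmetric]) (use B pq wc hc in auto)
  also have "(\<Oplus>\<^bsub>S\<^esub>j\<in>B. (h (d j p) \<otimes>\<^bsub>S\<^esub> w j) \<otimes>\<^bsub>S\<^esub> h q)
      = (\<Oplus>\<^bsub>S\<^esub>j\<in>B. h (d j p) \<otimes>\<^bsub>S\<^esub> w j) \<otimes>\<^bsub>S\<^esub> h q"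
    by (rule S.finsum_ldistr[symmetric]) (use B pq wc hc in auto)
  finally show ?thesis .
qed

section \<open>Finitely presented algebras and their Jacobian ideal\<close>

locale presented_algebra =
  fixes k :: "('a, 'm) ring_scheme" and n r :: nat and f :: "nat \<Rightarrow> nat multiset \<Rightarrow> 'a"
  assumes k_cring: "cring k"
    and f_closed: "\<And>i. i < r \<Longrightarrow> f i \<in> carrier (mpoly_algebra k n)"
begin

abbreviation "R \<equiv> mpoly_algebra k n"
abbreviation "I \<equiv> Idl\<^bsub>R\<^esub> (f ` {..<r})"
abbreviation "A \<equiv> FactAlgebra R I"
abbreviation "J \<equiv> Fitting_ideal k n r f r"
abbreviation "proj \<equiv> (+>\<^bsub>R\<^esub>) I"
abbreviation "const \<equiv> ring.indexed_const k :: 'a \<Rightarrow> nat multiset \<Rightarrow> 'a"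
abbreviation "indet \<equiv> ring.indexed_var k :: nat \<Rightarrow> nat multiset \<Rightarrow> 'a"

sublocale k: cring k by (rule k_cring)
sublocale R: cring R by (rule k.mpoly_algebra_cring)

lemma I_ideal: "ideal I R"
  by (rule R.genideal_ideal) (use f_closed in auto)

sublocale I: ideal I R by (rule I_ideal)
sublocale A: cring A by (rule FactAlgebra_cring[OF R.cring_axioms I_ideal])
sublocale proj: ring_hom_cring R A proj
  by (rule FactAlgebra_proj_hom[OF R.cring_axioms I_ideal])

lemma A_cases:
  assumes "x \<in> carrier A" obtains p where "p \<in> carrier R" "x = proj p"
  using assms unfolding FactAlgebra_proj_surj by blast

lemma proj_in_I: "p \<in> I \<Longrightarrow> proj p = \<zero>\<^bsub>A\<^esub>"
  using FactAlgebra_proj_kernel[OF R.cring_axioms I_ideal, of p "\<zero>\<^bsub>R\<^esub>"]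
  by (simp add: I.Icarr R.minus_eq)

lemma f_in_I: "i < r \<Longrightarrow> f i \<in> I"
  using R.genideal_self[of "f ` {..<r}"] f_closed by auto

lemma const_closed: "c \<in> carrier k \<Longrightarrow> const c \<in> carrier R"
  by (rule k.mpoly_const_closed)

text \<open>Scalars act through the structure map \<open>k \<rightarrow> A\<close>, so that \<open>k\<close>-linearity of maps on \<open>A\<close> can be
expressed by multiplication in \<open>A\<close>.\<close>

lemma smult_proj:
  assumes c: "c \<in> carrier k" and x: "x \<in> carrier A"
  shows "c \<odot>\<^bsub>A\<^esub> x = proj (const c) \<otimes>\<^bsub>A\<^esub> x"
proof -
  obtain p where p: "p \<in> carrier R" "x = proj p" using x by (rule A_cases)
  have eq: "I +>\<^bsub>R\<^esub> (c \<odot>\<^bsub>R\<^esub> y) = proj (const c) \<otimes>\<^bsub>A\<^esub> x" if "y \<in> proj p" for y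
  proof -
    have y: "y \<in> carrier R"
      using that p(1) R.a_r_coset_subset_G[OF I.a_subset p(1)] by auto
    have "proj y = proj p" 
      using I.a_repr_independence'[OF that p(1)] by simp
    then show ?thesis
      using c y p const_closed by (simp add: k.mpoly_smult_eq)
  qed
  have "p \<in> proj p" using p(1) by (rule I.a_rcos_self)
  then have "proj p \<noteq> {}" by blast
  moreover have "c \<odot>\<^bsub>A\<^esub> x = (\<Union>y\<in>proj p. proj (const c) \<otimes>\<^bsub>A\<^esub> x)"
    unfolding FactAlgebra_simps(6) by (rule SUP_cong) (simp_all only: p(2) eq)
  ultimately show ?thesis by simp
qed

lemma J_eq: "J = Idl\<^bsub>A\<^esub> (proj ` jacobian_minors k n r f r)"
  by (simp add: Fitting_ideal_def Let_def)

lemma pderiv_closed: "p \<in> carrier R \<Longrightarrow> mpoly_pderiv k j p \<in> carrier R"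
  by (simp add: k.mpoly_algebra_simps k.mpoly_pderiv_in_pset)

lemma pderiv_add:
  "\<lbrakk>p \<in> carrier R; q \<in> carrier R\<rbrakk>
    \<Longrightarrow> mpoly_pderiv k j (p \<oplus>\<^bsub>R\<^esub> q) = mpoly_pderiv k j p \<oplus>\<^bsub>R\<^esub> mpoly_pderiv k j q"
  by (simp add: k.mpoly_algebra_simps k.mpoly_pderiv_padd k.mpoly_carrier_coeff[of _ "{..<n}"])

lemma pderiv_mult:
  "\<lbrakk>p \<in> carrier R; q \<in> carrier R\<rbrakk>
    \<Longrightarrow> mpoly_pderiv k j (p \<otimes>\<^bsub>R\<^esub> q)
      = (mpoly_pderiv k j p \<otimes>\<^bsub>R\<^esub> q) \<oplus>\<^bsub>R\<^esub> (p \<otimes>\<^bsub>R\<^esub> mpoly_pderiv k j q)"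
  by (simp add: k.mpoly_algebra_simps k.mpoly_pderiv_mult[of _ "{..<n}"])

lemma pderiv_const: "mpoly_pderiv k j (const c) = \<zero>\<^bsub>R\<^esub>"
  by (simp add: k.mpoly_algebra_simps k.mpoly_pderiv_const)

text \<open>The classes of the Jacobian minors are minors of the Jacobian matrix over \<open>A\<close>, and there the
selected rows and columns are distinct.\<close>

lemma jacobian_minor_as_det:
  assumes "d \<in> proj ` jacobian_minors k n r f r"
  shows "\<exists>\<rho> \<gamma>. d = ring_det A r (\<lambda>i j. proj (mpoly_pderiv k (\<gamma> j) (f (\<rho> i))))
        \<and> inj_on \<rho> {..<r} \<and> \<rho> ` {..<r} \<subseteq> {..<r} \<and> inj_on \<gamma> {..<r} \<and> \<gamma> ` {..<r} \<subseteq> {..<n}"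
proof -
  obtain \<rho> \<gamma> where d: "d = proj (ring_det R r (\<lambda>i j. mpoly_pderiv k (\<gamma> j) (f (\<rho> i))))"
    and \<rho>: "strict_mono_on {..<r} \<rho>" "\<rho> ` {..<r} \<subseteq> {..<r}"
    and \<gamma>: "strict_mono_on {..<r} \<gamma>" "\<gamma> ` {..<r} \<subseteq> {..<n}"
    using assms unfolding jacobian_minors_def by blast
  have "d = ring_det A r (\<lambda>i j. proj (mpoly_pderiv k (\<gamma> j) (f (\<rho> i))))"
    unfolding d by (rule proj.hom_ring_det) (use \<rho>(2) pderiv_closed f_closed in auto)
  with \<rho> \<gamma> show ?thesis by (blast intro: strict_mono_on_imp_inj_on)
qed

lemma minors_closed: "proj ` jacobian_minors k n r f r \<subseteq> carrier A"
proof
  fix d assume "d \<in> proj ` jacobian_minors k n r f r"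
  from jacobian_minor_as_det[OF this] obtain \<rho> \<gamma>
    where d: "d = ring_det A r (\<lambda>i j. proj (mpoly_pderiv k (\<gamma> j) (f (\<rho> i))))"
      and \<rho>: "\<rho> ` {..<r} \<subseteq> {..<r}"
    by (elim exE conjE)
  show "d \<in> carrier A"
    unfolding d
  proof (rule A.ring_det_closed)
    fix i j assume "i < r"
    then have "\<rho> i < r" using \<rho> by auto
    then show "proj (mpoly_pderiv k (\<gamma> j) (f (\<rho> i))) \<in> carrier A"
      by (intro proj.hom_closed pderiv_closed f_closed)
  qed
qed

lemma J_ideal: "ideal J A"
  unfolding J_eq by (rule A.genideal_ideal[OF minors_closed])

sublocale J: ideal J A by (rule J_ideal)

lemma jacobian_system_solvable:
  assumes "\<And>i. i < r \<Longrightarrow> z i \<in> J \<cdot>\<^bsub>A\<^esub> J"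
  shows "\<exists>w\<in>{..<n} \<rightarrow> J. \<forall>i<r.
    (\<Oplus>\<^bsub>A\<^esub>j\<in>{..<n}. proj (mpoly_pderiv k j (f i)) \<otimes>\<^bsub>A\<^esub> w j) = z i"
proof (rule A.linear_system_solvable[OF _ J_eq])
  show "proj (mpoly_pderiv k j (f i)) \<in> carrier A" if "i < r" for i j
    using that by (intro proj.hom_closed pderiv_closed f_closed)
qed (rule jacobian_minor_as_det assms, assumption)+

lemma linear_mapsD:
  assumes "d \<in> linear_maps k A"
  shows "x \<in> carrier A \<Longrightarrow> d x \<in> carrier A"
    "x \<in> carrier A \<Longrightarrow> y \<in> carrier A \<Longrightarrow> d (x \<oplus>\<^bsub>A\<^esub> y) = d x \<oplus>\<^bsub>A\<^esub> d y"
    "c \<in> carrier k \<Longrightarrow> x \<in> carrier A \<Longrightarrow> d (proj (const c) \<otimes>\<^bsub>A\<^esub> x) = proj (const c) \<otimes>\<^bsub>A\<^esub> d x"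
    "d \<zero>\<^bsub>A\<^esub> = \<zero>\<^bsub>A\<^esub>"
proof -
  show cl: "d x \<in> carrier A" if "x \<in> carrier A" for x
    using assms that unfolding linear_maps_def by (auto simp: PiE_iff)
  show add: "d (x \<oplus>\<^bsub>A\<^esub> y) = d x \<oplus>\<^bsub>A\<^esub> d y" if "x \<in> carrier A" "y \<in> carrier A" for x y
    using assms that unfolding linear_maps_def by auto
  show "d (proj (const c) \<otimes>\<^bsub>A\<^esub> x) = proj (const c) \<otimes>\<^bsub>A\<^esub> d x"
    if "c \<in> carrier k" "x \<in> carrier A" for c x
  proof -
    have "d (c \<odot>\<^bsub>A\<^esub> x) = c \<odot>\<^bsub>A\<^esub> d x"
      using assms that unfolding linear_maps_def by simp
    then show ?thesis
      by (simp only: smult_proj[OF that] smult_proj[OF that(1) cl[OF that(2)]])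
  qed
  show "d \<zero>\<^bsub>A\<^esub> = \<zero>\<^bsub>A\<^esub>"
    using add[of "\<zero>\<^bsub>A\<^esub>" "\<zero>\<^bsub>A\<^esub>"] cl[of "\<zero>\<^bsub>A\<^esub>"] by (simp add: A.add.l_cancel_one')
qed

lemma linear_mapsI:
  assumes "d \<in> extensional (carrier A)" "\<And>x. x \<in> carrier A \<Longrightarrow> d x \<in> carrier A"
    "\<And>x y. x \<in> carrier A \<Longrightarrow> y \<in> carrier A \<Longrightarrow> d (x \<oplus>\<^bsub>A\<^esub> y) = d x \<oplus>\<^bsub>A\<^esub> d y"
    "\<And>c x. c \<in> carrier k \<Longrightarrow> x \<in> carrier A
      \<Longrightarrow> d (proj (const c) \<otimes>\<^bsub>A\<^esub> x) = proj (const c) \<otimes>\<^bsub>A\<^esub> d x"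
  shows "d \<in> linear_maps k A"
  unfolding linear_maps_def mem_Collect_eq PiE_iff
  by (intro conjI ballI) (simp_all only: assms smult_proj)

end
section \<open>Extending a truncated Hasse-Schmidt derivation by one order\<close>

lemma UP_carrier: "carrier (UP A) = up A"
  by (simp add: UP_def)

lemma UP_coeff: "u \<in> up A \<Longrightarrow> coeff (UP A) u i = u i"
  by (simp add: UP_def)

context presented_algebra
begin

text \<open>The invariant of the construction: Hasse-Schmidt conditions in the orders below \<open>N\<close>, together with
the requirement that the components of positive order take values in \<open>J\<close>.\<close>

definition hs_below :: "nat \<Rightarrow> (nat \<Rightarrow> (nat multiset \<Rightarrow> 'a) set \<Rightarrow> (nat multiset \<Rightarrow> 'a) set) \<Rightarrow> bool"
  where "hs_below N D \<longleftrightarrow> 0 < N \<and> D 0 = (\<lambda>x\<in>carrier A. x) \<and>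
    (\<forall>i<N. D i \<in> linear_maps k A \<and> leibniz_rule A A D i \<and> (0 < i \<longrightarrow> D i ` carrier A \<subseteq> J))"

lemma hs_below_proj_const:
  assumes D: "hs_below N D" and "i < N" "c \<in> carrier k"
  shows "D i (proj (const c)) = (if i = 0 then proj (const c) else \<zero>\<^bsub>A\<^esub>)"
proof (cases "i = 0")
  case False
  have lin: "D j \<in> linear_maps k A" if "j < N" for j using D that by (simp add: hs_below_def)
  have "D i \<one>\<^bsub>A\<^esub> = \<zero>\<^bsub>A\<^esub>"
    by (rule A.leibniz_rule_one[where N = N])
       (use D False assms(2) linear_mapsD(1)[OF lin] in \<open>auto simp: hs_below_def\<close>)
  then show ?thesis
    using False linear_mapsD(3)[OF lin[OF assms(2)] assms(3) A.one_closed] const_closed[OF assms(3)]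
    by simp
qed (use D const_closed[OF assms(3)] in \<open>simp add: hs_below_def\<close>)

text \<open>\<open>E\<^sub>i(p)\<close> is the coefficient of \<open>t\<^sup>i\<close> in the value at \<open>p\<close> of the homomorphism that sends \<open>x\<^sub>j\<close> to the
polynomial with coefficients \<open>D\<^sub>i(x\<^sub>j)\<close> for \<open>i < N\<close>. The coefficient of \<open>t\<^sup>N\<close> in this image of \<open>x\<^sub>j\<close> is zero, so
in the Leibniz rule for \<open>E\<^sub>N(x\<^sub>j p)\<close> one outer term is zero, the other one is a multiple of \<open>E\<^sub>N(p)\<close>, and
the inner ones are products of two elements of \<open>J\<close>.\<close>

lemma lift_to_polynomial_ring:
  assumes D: "hs_below N D"
  obtains E where "\<And>i p. p \<in> carrier R \<Longrightarrow> E i p \<in> carrier A"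
    and "\<And>i p q. p \<in> carrier R \<Longrightarrow> q \<in> carrier R \<Longrightarrow> E i (p \<oplus>\<^bsub>R\<^esub> q) = E i p \<oplus>\<^bsub>A\<^esub> E i q"
    and "\<And>i. leibniz_rule R A E i"
    and "\<And>i c. c \<in> carrier k \<Longrightarrow> E i (const c) = (if i = 0 then proj (const c) else \<zero>\<^bsub>A\<^esub>)"
    and "\<And>i p. i < N \<Longrightarrow> p \<in> carrier R \<Longrightarrow> E i p = D i (proj p)"
    and "\<And>p. p \<in> carrier R \<Longrightarrow> E N p \<in> J \<cdot>\<^bsub>A\<^esub> J"
proof -
  interpret U: UP_cring A "UP A"
    by unfold_locales simp
  define h where "h c = monom (UP A) (proj (const c)) 0" for c
  have hom: "ring_hom_cring k (UP A) h"
  proof (rule ring_hom_cringI[OF k_cring U.UP_cring])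
    have "proj \<circ> const \<in> ring_hom k A"
      by (rule ring_hom_trans[OF k.mpoly_const_hom[of n] proj.homh])
    from ring_hom_trans[OF this U.const_ring_hom] show "h \<in> ring_hom k (UP A)"
      by (simp add: h_def[abs_def] comp_def)
  qed
  interpret h: ring_hom_cring k "UP A" h by (rule hom)
  have N: "0 < N" and D0: "D 0 = (\<lambda>x\<in>carrier A. x)"
    and lin: "\<And>i. i < N \<Longrightarrow> D i \<in> linear_maps k A" 
    and leib: "\<And>i. i < N \<Longrightarrow> leibniz_rule A A D i"
    and DJ: "\<And>i x. 0 < i \<Longrightarrow> i < N \<Longrightarrow> x \<in> carrier A \<Longrightarrow> D i x \<in> J"
    using D by (auto simp: hs_below_def)
  have Dc: "D i x \<in> carrier A" if "i < N" "x \<in> carrier A" for i x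
    using linear_mapsD(1)[OF lin] that by blast
  have indet: "indet j \<in> carrier R" if "j < n" for j using that by (rule k.mpoly_var_closed)
  define s where "s j i = (if i < N then D i (proj (indet j)) else \<zero>\<^bsub>A\<^esub>)" for j i
  have s_up: "s j \<in> up A" if "j < n" for j
    using Dc indet[OF that] by (intro mem_upI exI[of _ N] bound.intro) (auto simp: s_def)
  then have s: "s \<in> {..<n} \<rightarrow> carrier (UP A)" by (auto simp: UP_carrier)
  define g where "g = h.mpoly_eval s n"
  define E where "E i p = coeff (UP A) (g p) i" for i p
  have g: "g \<in> ring_hom R (UP A)" unfolding g_def by (rule h.mpoly_eval_hom[OF s])
  note gm = ring_hom_closed[OF g] ring_hom_add[OF g] ring_hom_mult[OF g]
  have E1: "E i p \<in> carrier A" if "p \<in> carrier R" for i p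
    using gm(1)[OF that] by (simp add: E_def)
  have E2: "E i (p \<oplus>\<^bsub>R\<^esub> q) = E i p \<oplus>\<^bsub>A\<^esub> E i q" if "p \<in> carrier R" "q \<in> carrier R" for i p q
    using gm that by (simp add: E_def)
  have E3: "leibniz_rule R A E i" for i
    using gm by (simp add: E_def leibniz_rule_def)
  have E4: "E i (const c) = (if i = 0 then proj (const c) else \<zero>\<^bsub>A\<^esub>)" if "c \<in> carrier k" for i c
    using that const_closed[OF that] h.mpoly_eval_const[OF s that]
    by (simp add: E_def g_def h_def)
  have Evar: "E i (indet j) = s j i" if "j < n" for i j
    unfolding E_def g_def h.mpoly_eval_var[OF s that] using s_up[OF that] by (rule UP_coeff)
  have E5: "E i p = D i (proj p)" if "i < N" "p \<in> carrier R" for i p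
    using that(2,1)
  proof (induction arbitrary: i rule: k.mpoly_induct)
    case (const c)
    then show ?case by (simp add: E4 hs_below_proj_const[OF D])
  next
    case (add p q)
    then show ?case by (simp add: E2 linear_mapsD(2)[OF lin])
  next
    case (var j p)
    have "E i (indet j \<otimes>\<^bsub>R\<^esub> p) = (\<Oplus>\<^bsub>A\<^esub>l\<in>{..i}. E l (indet j) \<otimes>\<^bsub>A\<^esub> E (i - l) p)"
      by (rule leibniz_ruleD[OF E3]) (use var indet in auto)
    also have "\<dots> = (\<Oplus>\<^bsub>A\<^esub>l\<in>{..i}. D l (proj (indet j)) \<otimes>\<^bsub>A\<^esub> D (i - l) (proj p))"
      by (rule A.finsum_cong') (use var Dc indet in \<open>auto simp: Evar s_def\<close>)
    also have "\<dots> = D i (proj (indet j \<otimes>\<^bsub>R\<^esub> p))"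
      using leibniz_ruleD[OF leib[OF var.prems], of "proj (indet j)" "proj p"] var indet by simp
    finally show ?case .
  qed
  have JJ: "ideal (J \<cdot>\<^bsub>A\<^esub> J) A" by (rule A.ideal_prod_is_ideal[OF J_ideal J_ideal])
  interpret JJ: ideal "J \<cdot>\<^bsub>A\<^esub> J" A by (rule JJ)
  have E6: "E N p \<in> J \<cdot>\<^bsub>A\<^esub> J" if "p \<in> carrier R" for p
    using that
  proof (induction rule: k.mpoly_induct)
    case (const c)
    then show ?case using N by (simp add: E4)
  next
    case (add p q)
    then show ?case by (simp add: E2)
  next
    case (var j p)
    have "E N (indet j \<otimes>\<^bsub>R\<^esub> p) = (\<Oplus>\<^bsub>A\<^esub>l\<in>{..N}. E l (indet j) \<otimes>\<^bsub>A\<^esub> E (N - l) p)"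
      by (rule leibniz_ruleD[OF E3]) (use var indet in auto)
    also have "\<dots> \<in> J \<cdot>\<^bsub>A\<^esub> J"
    proof (rule A.finsum_in_ideal[OF JJ])
      fix l assume l: "l \<in> {..N}"
      consider "l = 0" | "l = N" | "0 < l" "l < N" using l by fastforce
      then show "E l (indet j) \<otimes>\<^bsub>A\<^esub> E (N - l) p \<in> J \<cdot>\<^bsub>A\<^esub> J"
      proof cases
        case 1
        then show ?thesis using var indet E1 by (auto intro!: JJ.I_l_closed)
      next
        case 2
        then show ?thesis using var E1 by (simp add: Evar s_def)
      next
        case 3
        then show ?thesis
          using var indet by (intro ideal_prod.prod) (auto simp: E5 intro!: DJ)
      qed
    qed
    finally show ?case .
  qed
  show ?thesis by (rule that[of E]) (fact E1 E2 E3 E4 E5 E6)+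
qed

text \<open>The maps called \<open>F\<close> in the proof are the lifted components with the one of order \<open>N\<close> corrected by
the derivation \<open>L\<close>. The correction makes \<open>F\<^sub>N\<close> vanish on each relation; the Leibniz rule spreads
this to the ideal \<open>I\<close>, because the components of lower order vanish on \<open>I\<close> already.\<close>

lemma hs_extend:
  assumes D: "hs_below N D"
  shows "\<exists>d\<in>linear_maps k A. d ` carrier A \<subseteq> J
    \<and> leibniz_rule A A (\<lambda>i. if i < N then D i else d) N"
proof -
  obtain E where E1: "\<And>i p. p \<in> carrier R \<Longrightarrow> E i p \<in> carrier A"
    and E2: "\<And>i p q. p \<in> carrier R \<Longrightarrow> q \<in> carrier R \<Longrightarrow> E i (p \<oplus>\<^bsub>R\<^esub> q) = E i p \<oplus>\<^bsub>A\<^esub> E i q"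
    and E3: "\<And>i. leibniz_rule R A E i"
    and E4: "\<And>i c. c \<in> carrier k \<Longrightarrow> E i (const c) = (if i = 0 then proj (const c) else \<zero>\<^bsub>A\<^esub>)"
    and E5: "\<And>i p. i < N \<Longrightarrow> p \<in> carrier R \<Longrightarrow> E i p = D i (proj p)"
    and E6: "\<And>p. p \<in> carrier R \<Longrightarrow> E N p \<in> J \<cdot>\<^bsub>A\<^esub> J"
    by (rule lift_to_polynomial_ring[OF D]) blast
  have N: "0 < N" and D0: "D 0 = (\<lambda>x\<in>carrier A. x)"
    and lin: "\<And>i. i < N \<Longrightarrow> D i \<in> linear_maps k A"
    using D by (auto simp: hs_below_def)
  interpret JJ: ideal "J \<cdot>\<^bsub>A\<^esub> J" A by (rule A.ideal_prod_is_ideal[OF J_ideal J_ideal])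
  have JJ_sub: "J \<cdot>\<^bsub>A\<^esub> J \<subseteq> J" using A.ideal_prod_inter[OF J_ideal J_ideal] by blast
  have "\<exists>w\<in>{..<n} \<rightarrow> J. \<forall>i<r.
      (\<Oplus>\<^bsub>A\<^esub>j\<in>{..<n}. proj (mpoly_pderiv k j (f i)) \<otimes>\<^bsub>A\<^esub> w j) = \<ominus>\<^bsub>A\<^esub> E N (f i)"
    by (rule jacobian_system_solvable) (use E6 f_closed in auto)
  then obtain w where w: "w \<in> {..<n} \<rightarrow> J"
    and wf: "\<And>i. i < r \<Longrightarrow>
      (\<Oplus>\<^bsub>A\<^esub>j\<in>{..<n}. proj (mpoly_pderiv k j (f i)) \<otimes>\<^bsub>A\<^esub> w j) = \<ominus>\<^bsub>A\<^esub> E N (f i)"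
    by blast
  have wJ: "w j \<in> J" if "j < n" for j using w that by auto
  have wc: "w j \<in> carrier A" if "j < n" for j using wJ[OF that] by (rule J.Icarr)
  \<comment> \<open>\<open>L\<close> is the derivation with \<open>L(x\<^sub>j) = w\<^sub>j\<close>.\<close>
  define L where "L p = (\<Oplus>\<^bsub>A\<^esub>j\<in>{..<n}. proj (mpoly_pderiv k j p) \<otimes>\<^bsub>A\<^esub> w j)" for p
  have LJ: "L p \<in> J" if "p \<in> carrier R" for p
    unfolding L_def
    by (rule A.finsum_in_ideal[OF J_ideal])
       (use that wJ in \<open>auto intro!: J.I_l_closed proj.hom_closed pderiv_closed\<close>)
  have Lc: "L p \<in> carrier A" if "p \<in> carrier R" for p using LJ[OF that] by (rule J.Icarr)
  have Ladd: "L (p \<oplus>\<^bsub>R\<^esub> q) = L p \<oplus>\<^bsub>A\<^esub> L q" if "p \<in> carrier R" "q \<in> carrier R" for p q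
  proof -
    have "L (p \<oplus>\<^bsub>R\<^esub> q) = (\<Oplus>\<^bsub>A\<^esub>j\<in>{..<n}. (proj (mpoly_pderiv k j p) \<otimes>\<^bsub>A\<^esub> w j)
        \<oplus>\<^bsub>A\<^esub> (proj (mpoly_pderiv k j q) \<otimes>\<^bsub>A\<^esub> w j))"
      unfolding L_def
      by (rule A.finsum_cong')
         (use that wc in \<open>auto simp: pderiv_add pderiv_closed A.l_distr simp del: A.finsum_addf\<close>)
    also have "\<dots> = L p \<oplus>\<^bsub>A\<^esub> L q"
      unfolding L_def by (rule A.finsum_addf) (use that wc in \<open>auto simp: pderiv_closed\<close>)
    finally show ?thesis .
  qed
  have Lconst: "L (const c) = \<zero>\<^bsub>A\<^esub>" if "c \<in> carrier k" for c
    unfolding L_def pderiv_const by (rule A.add.finprod_one_eqI) (use wc in auto)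
  have Lmult: "L (p \<otimes>\<^bsub>R\<^esub> q) = (proj p \<otimes>\<^bsub>A\<^esub> L q) \<oplus>\<^bsub>A\<^esub> (L p \<otimes>\<^bsub>A\<^esub> proj q)"
    if "p \<in> carrier R" "q \<in> carrier R" for p q
    unfolding L_def
    by (rule proj.finsum_derivations) (use that wc pderiv_closed pderiv_mult in auto)
  define F where "F i p = (if i = N then E N p \<oplus>\<^bsub>A\<^esub> L p else E i p)" for i p
  have Fc: "F i p \<in> carrier A" if "p \<in> carrier R" for i p
    using that E1 Lc by (simp add: F_def)
  have Fproj: "F i p = D i (proj p)" if "i < N" "p \<in> carrier R" for i p
    using that E5 by (simp add: F_def)
  have F0: "F 0 p = proj p" if "p \<in> carrier R" for p
    using that Fproj[OF N that] by (simp add: D0)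
  have FJ: "F N p \<in> J" if "p \<in> carrier R" for p
    using E6[OF that] JJ_sub LJ[OF that] by (auto simp: F_def)
  have Fadd: "F N (p \<oplus>\<^bsub>R\<^esub> q) = F N p \<oplus>\<^bsub>A\<^esub> F N q" if "p \<in> carrier R" "q \<in> carrier R" for p q
  proof -
    have "(a \<oplus>\<^bsub>A\<^esub> b) \<oplus>\<^bsub>A\<^esub> (c \<oplus>\<^bsub>A\<^esub> e) = (a \<oplus>\<^bsub>A\<^esub> c) \<oplus>\<^bsub>A\<^esub> (b \<oplus>\<^bsub>A\<^esub> e)"
      if "a \<in> carrier A" "b \<in> carrier A" "c \<in> carrier A" "e \<in> carrier A" for a b c e
      using that by (simp add: A.a_ac)
    with that E1 Lc show ?thesis by (simp add: F_def E2 Ladd)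
  qed
  have Fconst: "F i (const c) = (if i = 0 then proj (const c) else \<zero>\<^bsub>A\<^esub>)"
    if "c \<in> carrier k" for i c
    using that N by (simp add: F_def E4 Lconst)
  have Fmult: "F N (p \<otimes>\<^bsub>R\<^esub> q) = (\<Oplus>\<^bsub>A\<^esub>i\<in>{..N}. F i p \<otimes>\<^bsub>A\<^esub> F (N - i) q)"
    if p: "p \<in> carrier R" and q: "q \<in> carrier R" for p q
  proof -
    define M where "M = (\<Oplus>\<^bsub>A\<^esub>i\<in>{0<..<N}. E i p \<otimes>\<^bsub>A\<^esub> E (N - i) q)"
    have M: "M \<in> carrier A" unfolding M_def using E1 p q by (auto intro!: A.finsum_closed)
    have E0: "E 0 x = proj x" if "x \<in> carrier R" for x using F0[OF that] N by (simp add: F_def)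
    have "E N (p \<otimes>\<^bsub>R\<^esub> q) = (\<Oplus>\<^bsub>A\<^esub>i\<in>{..N}. E i p \<otimes>\<^bsub>A\<^esub> E (N - i) q)"
      by (rule leibniz_ruleD[OF E3 p q])
    also have "\<dots> = proj p \<otimes>\<^bsub>A\<^esub> E N q \<oplus>\<^bsub>A\<^esub> (E N p \<otimes>\<^bsub>A\<^esub> proj q \<oplus>\<^bsub>A\<^esub> M)"
      unfolding M_def using E1 p q N by (subst A.finsum_atMost_ends) (auto simp: E0)
    finally have Epq: "E N (p \<otimes>\<^bsub>R\<^esub> q)
      = proj p \<otimes>\<^bsub>A\<^esub> E N q \<oplus>\<^bsub>A\<^esub> (E N p \<otimes>\<^bsub>A\<^esub> proj q \<oplus>\<^bsub>A\<^esub> M)" .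
    have "(\<Oplus>\<^bsub>A\<^esub>i\<in>{..N}. F i p \<otimes>\<^bsub>A\<^esub> F (N - i) q)
        = proj p \<otimes>\<^bsub>A\<^esub> F N q \<oplus>\<^bsub>A\<^esub>
          (F N p \<otimes>\<^bsub>A\<^esub> proj q \<oplus>\<^bsub>A\<^esub> (\<Oplus>\<^bsub>A\<^esub>i\<in>{0<..<N}. F i p \<otimes>\<^bsub>A\<^esub> F (N - i) q))"
      using Fc p q N by (subst A.finsum_atMost_ends) (auto simp: F0)
    also have "(\<Oplus>\<^bsub>A\<^esub>i\<in>{0<..<N}. F i p \<otimes>\<^bsub>A\<^esub> F (N - i) q) = M"
      unfolding M_def by (rule A.finsum_cong') (use E1 p q in \<open>auto simp: F_def\<close>)
    also have "proj p \<otimes>\<^bsub>A\<^esub> F N q \<oplus>\<^bsub>A\<^esub> (F N p \<otimes>\<^bsub>A\<^esub> proj q \<oplus>\<^bsub>A\<^esub> M)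
        = F N (p \<otimes>\<^bsub>R\<^esub> q)"
    proof -
      have "a \<otimes>\<^bsub>A\<^esub> (b \<oplus>\<^bsub>A\<^esub> c) \<oplus>\<^bsub>A\<^esub> ((b' \<oplus>\<^bsub>A\<^esub> c') \<otimes>\<^bsub>A\<^esub> a' \<oplus>\<^bsub>A\<^esub> m)
        = (a \<otimes>\<^bsub>A\<^esub> b \<oplus>\<^bsub>A\<^esub> (b' \<otimes>\<^bsub>A\<^esub> a' \<oplus>\<^bsub>A\<^esub> m)) \<oplus>\<^bsub>A\<^esub> (a \<otimes>\<^bsub>A\<^esub> c \<oplus>\<^bsub>A\<^esub> c' \<otimes>\<^bsub>A\<^esub> a')"
        if "a \<in> carrier A" "b \<in> carrier A" "c \<in> carrier A" "a' \<in> carrier A" "b' \<in> carrier A"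
          "c' \<in> carrier A" "m \<in> carrier A" for a b c a' b' c' m
        using that by (simp add: A.l_distr A.r_distr A.a_ac)
      then show ?thesis
        using p q M E1 Lc by (simp add: F_def Epq Lmult)
    qed
    finally show ?thesis by simp
  qed
  have Fzero: "F N p = \<zero>\<^bsub>A\<^esub>" if "p \<in> I" for p
  proof -
    \<comment> \<open>\<open>F\<^sub>N\<close> is not linear over the polynomial ring, but its zeros inside \<open>I\<close> form an ideal.\<close>
    define K where "K = {p \<in> I. F N p = \<zero>\<^bsub>A\<^esub>}"
    have "ideal K R"
    proof (rule R.idealI_lmult)
      show "K \<subseteq> carrier R" using I.a_subset by (auto simp: K_def)
      have "F N \<zero>\<^bsub>R\<^esub> = \<zero>\<^bsub>A\<^esub>"
        unfolding k.mpoly_algebra_simps(4) using N by (simp add: Fconst)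
      then show "\<zero>\<^bsub>R\<^esub> \<in> K" by (simp add: K_def)
      show "a \<oplus>\<^bsub>R\<^esub> b \<in> K" if "a \<in> K" "b \<in> K" for a b
        using that by (simp add: K_def Fadd I.Icarr)
      show "x \<otimes>\<^bsub>R\<^esub> a \<in> K" if a: "a \<in> K" and x: "x \<in> carrier R" for a x
      proof -
        have aI: "a \<in> I" and FNa: "F N a = \<zero>\<^bsub>A\<^esub>" and ac: "a \<in> carrier R"
          using a I.Icarr by (auto simp: K_def)
        have "F i a = \<zero>\<^bsub>A\<^esub>" if "i \<le> N" for i
          using that FNa Fproj[OF _ ac, of i] linear_mapsD(4)[OF lin, of i] proj_in_I[OF aI]
          by (cases "i = N") auto
        then have "F N (x \<otimes>\<^bsub>R\<^esub> a) = \<zero>\<^bsub>A\<^esub>"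
          unfolding Fmult[OF x ac]
          by (intro A.add.finprod_one_eqI) (use Fc x in auto)
        then show ?thesis using aI x by (simp add: K_def I.I_l_closed)
      qed
    qed
    moreover have "f ` {..<r} \<subseteq> K"
      using f_in_I wf E1 f_closed by (auto simp: K_def F_def L_def A.r_neg)
    ultimately have "I \<subseteq> K" by (rule R.genideal_minimal)
    with that show ?thesis by (auto simp: K_def)
  qed
  have Feq: "F N p = F N q" if "p \<in> carrier R" "q \<in> carrier R" "proj p = proj q" for p q
  proof -
    have I: "p \<ominus>\<^bsub>R\<^esub> q \<in> I"
      using that FactAlgebra_proj_kernel[OF R.cring_axioms I_ideal] by blast
    have "p = (p \<ominus>\<^bsub>R\<^esub> q) \<oplus>\<^bsub>R\<^esub> q" using that by algebra
    then have "F N p = F N (p \<ominus>\<^bsub>R\<^esub> q) \<oplus>\<^bsub>A\<^esub> F N q"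
      using Fadd[of "p \<ominus>\<^bsub>R\<^esub> q" q] that by simp
    then show ?thesis using Fzero[OF I] Fc that by simp
  qed
  \<comment> \<open>By \<open>Feq\<close>, the choice of the representative does not matter.\<close>
  define d where "d = (\<lambda>x\<in>carrier A. F N (SOME p. p \<in> carrier R \<and> proj p = x))"
  have d: "d (proj p) = F N p" if "p \<in> carrier R" for p
  proof -
    define q where "q = (SOME p'. p' \<in> carrier R \<and> proj p' = proj p)"
    have "q \<in> carrier R \<and> proj q = proj p"
      unfolding q_def by (rule someI[of _ p]) (use that in auto)
    then have "F N q = F N p" using Feq that by blast
    moreover have "d (proj p) = F N q"
      unfolding d_def q_def by (rule restrict_apply') (rule proj.hom_closed[OF that])
    ultimately show ?thesis by simp
  qed
  have FD: "F i p = (if i < N then D i else d) (proj p)" if "i \<le> N" "p \<in> carrier R" for i p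
    using that Fproj d by (cases "i = N") auto
  show ?thesis
  proof (intro bexI conjI)
    show "d \<in> linear_maps k A"
    proof (rule linear_mapsI)
      show "d \<in> extensional (carrier A)" by (simp add: d_def)
    next
      fix x assume "x \<in> carrier A"
      then show "d x \<in> carrier A" by (rule A_cases) (simp add: d Fc)
    next
      fix x y assume "x \<in> carrier A" "y \<in> carrier A"
      then obtain p q where "p \<in> carrier R" "x = proj p" "q \<in> carrier R" "y = proj q"
        by (metis A_cases)
      then show "d (x \<oplus>\<^bsub>A\<^esub> y) = d x \<oplus>\<^bsub>A\<^esub> d y"
        using d[of "p \<oplus>\<^bsub>R\<^esub> q"] by (simp add: d Fadd)
    next
      fix c x assume c: "c \<in> carrier k" and "x \<in> carrier A"
      then obtain p where p: "p \<in> carrier R" "x = proj p" by (metis A_cases)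
      have cR: "const c \<in> carrier R" using c by (rule const_closed)
      have "F N (const c \<otimes>\<^bsub>R\<^esub> p) = proj (const c) \<otimes>\<^bsub>A\<^esub> F N p
          \<oplus>\<^bsub>A\<^esub> (F N (const c) \<otimes>\<^bsub>A\<^esub> proj p
          \<oplus>\<^bsub>A\<^esub> (\<Oplus>\<^bsub>A\<^esub>i\<in>{0<..<N}. F i (const c) \<otimes>\<^bsub>A\<^esub> F (N - i) p))"
        using Fmult[OF cR p(1)] Fc cR p N by (subst (asm) A.finsum_atMost_ends) (auto simp: F0)
      also have "(\<Oplus>\<^bsub>A\<^esub>i\<in>{0<..<N}. F i (const c) \<otimes>\<^bsub>A\<^esub> F (N - i) p) = \<zero>\<^bsub>A\<^esub>"
        by (rule A.add.finprod_one_eqI) (use Fc p c in \<open>auto simp: Fconst\<close>)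
      finally have "F N (const c \<otimes>\<^bsub>R\<^esub> p) = proj (const c) \<otimes>\<^bsub>A\<^esub> F N p"
        using N c cR p Fc by (simp add: Fconst)
      then show "d (proj (const c) \<otimes>\<^bsub>A\<^esub> x) = proj (const c) \<otimes>\<^bsub>A\<^esub> d x"
        using d[of "const c \<otimes>\<^bsub>R\<^esub> p"] p cR by (simp add: d)
    qed
    show "d ` carrier A \<subseteq> J"
    proof
      fix y assume "y \<in> d ` carrier A"
      then obtain x where "x \<in> carrier A" "y = d x" by blast
      then show "y \<in> J" by (metis A_cases d FJ)
    qed
    show "leibniz_rule A A (\<lambda>i. if i < N then D i else d) N"
      unfolding leibniz_rule_def
    proof (intro ballI)
      fix x y assume "x \<in> carrier A" "y \<in> carrier A"
      then obtain p q where p: "p \<in> carrier R" "x = proj p" and q: "q \<in> carrier R" "y = proj q"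
        by (metis A_cases)
      have "d (proj (p \<otimes>\<^bsub>R\<^esub> q)) = (\<Oplus>\<^bsub>A\<^esub>i\<in>{..N}. F i p \<otimes>\<^bsub>A\<^esub> F (N - i) q)"
        using d[of "p \<otimes>\<^bsub>R\<^esub> q"] Fmult p q by simp
      also have "\<dots> = (\<Oplus>\<^bsub>A\<^esub>i\<in>{..N}. (if i < N then D i else d) (proj p)
          \<otimes>\<^bsub>A\<^esub> (if N - i < N then D (N - i) else d) (proj q))"
        by (rule A.finsum_cong')
           (use Fc p q FD[OF _ p(1)] FD[OF _ q(1)] in \<open>auto simp flip: FD\<close>)
      finally show "(if N < N then D N else d) (x \<otimes>\<^bsub>A\<^esub> y)
        = (\<Oplus>\<^bsub>A\<^esub>i\<in>{..N}. (if i < N then D i else d) x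
          \<otimes>\<^bsub>A\<^esub> (if N - i < N then D (N - i) else d) y)"
        using p q by simp
    qed
  qed
qed

section \<open>Integrability\<close>

text \<open>Orders \<open>0\<close> and \<open>1\<close> are prescribed; from order \<open>2\<close> on each component is chosen by \<open>hs_extend\<close>.
Since the choice at order \<open>N\<close> depends on all the earlier ones, this is a dependent choice with
course-of-values recursion, in which the components at and above \<open>N\<close> must not enter the condition
at \<open>N\<close>.\<close>

lemma integrable_if_image_in_J:
  assumes \<delta>: "\<delta> \<in> carrier (Der k A)" and \<delta>J: "\<delta> ` carrier A \<subseteq> J"
  shows "\<delta> \<in> IDer k A"
proof -
  have \<delta>lin: "\<delta> \<in> linear_maps k A"
    and \<delta>mult: "\<And>x y. x \<in> carrier A \<Longrightarrow> y \<in> carrier A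
      \<Longrightarrow> \<delta> (x \<otimes>\<^bsub>A\<^esub> y) = (\<delta> x \<otimes>\<^bsub>A\<^esub> y) \<oplus>\<^bsub>A\<^esub> (x \<otimes>\<^bsub>A\<^esub> \<delta> y)"
    using \<delta> by (auto simp: Der_def)
  define step where "step D N d \<longleftrightarrow> d \<in> linear_maps k A \<and> (N = 0 \<longrightarrow> d = (\<lambda>x\<in>carrier A. x))
    \<and> (N = 1 \<longrightarrow> d = \<delta>) \<and> (0 < N \<longrightarrow> d ` carrier A \<subseteq> J)
    \<and> leibniz_rule A A (\<lambda>i. if i < N then D i else d) N" for D N d
  have step_below: "leibniz_rule A A D N" 
    if L: "step D N (D N)" and lin: "\<And>i. i \<le> N \<Longrightarrow> D i \<in> linear_maps k A" for D N
  proof -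
    have below: "(if i < N then D i else D N) = D i" if "i \<le> N" for i using that by auto
    have cl: "D i x \<in> carrier A" if "i \<le> N" "x \<in> carrier A" for i x
      using linear_mapsD(1)[OF lin[OF that(1)] that(2)] .
    show ?thesis
      unfolding leibniz_rule_def
    proof (intro ballI)
      fix x y assume xy: "x \<in> carrier A" "y \<in> carrier A"
      have "leibniz_rule A A (\<lambda>i. if i < N then D i else D N) N" using L by (simp add: step_def)
      from leibniz_ruleD[OF this xy] have "D N (x \<otimes>\<^bsub>A\<^esub> y)
        = (\<Oplus>\<^bsub>A\<^esub>i\<in>{..N}. (if i < N then D i else D N) x
            \<otimes>\<^bsub>A\<^esub> (if N - i < N then D (N - i) else D N) y)"
        by simp
      also have "\<dots> = (\<Oplus>\<^bsub>A\<^esub>i\<in>{..N}. D i x \<otimes>\<^bsub>A\<^esub> D (N - i) y)"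
        by (rule A.finsum_cong') (use cl xy below in auto)
      finally show "D N (x \<otimes>\<^bsub>A\<^esub> y) = (\<Oplus>\<^bsub>A\<^esub>i\<in>{..N}. D i x \<otimes>\<^bsub>A\<^esub> D (N - i) y)" .
    qed
  qed
  have "\<exists>D. \<forall>N. step D N (D N)"
  proof (rule dependent_wellorder_choice)
    fix d :: "(nat multiset \<Rightarrow> 'a) set \<Rightarrow> (nat multiset \<Rightarrow> 'a) set"
      and D D' :: "nat \<Rightarrow> (nat multiset \<Rightarrow> 'a) set \<Rightarrow> (nat multiset \<Rightarrow> 'a) set" and N :: nat
    assume "\<And>i. i < N \<Longrightarrow> D i = D' i"
    then have "(\<lambda>i. if i < N then D i else d) = (\<lambda>i. if i < N then D' i else d)" by auto
    then show "step D N d = step D' N d" by (simp only: step_def)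
  next
    fix N :: nat and D
    assume prev: "\<And>i. i < N \<Longrightarrow> step D i (D i)"
    consider "N = 0" | "N = 1" | "1 < N" by linarith
    then show "\<exists>d. step D N d"
    proof cases
      case 1
      have "step D 0 (\<lambda>x\<in>carrier A. x)"
        unfolding step_def
      proof (intro conjI impI)
        show "(\<lambda>x\<in>carrier A. x) \<in> linear_maps k A"
          by (rule linear_mapsI) (auto intro!: A.m_closed proj.hom_closed const_closed)
        show "leibniz_rule A A (\<lambda>i. if i < 0 then D i else (\<lambda>x\<in>carrier A. x)) 0"
          by (simp add: leibniz_rule_def)
      qed simp_all
      with 1 show ?thesis by blast
    next
      case 2
      have D0: "D 0 = (\<lambda>x\<in>carrier A. x)" using prev[of 0] 2 by (simp add: step_def)
      have "leibniz_rule A A (\<lambda>i. if i < 1 then D i else \<delta>) 1"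
        using linear_mapsD(1)[OF \<delta>lin]
        by (auto simp: leibniz_rule_def D0 \<delta>mult A.a_comm)
      then have "step D 1 \<delta>" using \<delta>lin \<delta>J by (simp add: step_def)
      with 2 show ?thesis by blast
    next
      case 3
      have lin: "D i \<in> linear_maps k A" if "i < N" for i
        using prev[OF that] by (simp add: step_def)
      have "D 0 = (\<lambda>x\<in>carrier A. x)"
        using prev[of 0] 3 by (simp add: step_def)
      moreover have "D i ` carrier A \<subseteq> J" if "i < N" "0 < i" for i
        using prev[OF that(1)] that(2) by (simp add: step_def)
      moreover have "leibniz_rule A A D i" if "i < N" for i
        by (rule step_below[OF prev[OF that]]) (use that lin in simp)
      ultimately have "hs_below N D"
        unfolding hs_below_def using 3 lin by simp
      then obtain d where "d \<in> linear_maps k A" "d ` carrier A \<subseteq> J"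
        "leibniz_rule A A (\<lambda>i. if i < N then D i else d) N"
        using hs_extend by blast
      then have "step D N d" using 3 by (simp add: step_def)
      then show ?thesis by blast
    qed
  qed
  then obtain D where D: "\<And>N. step D N (D N)" by blast
  have lin: "D N \<in> linear_maps k A" for N using D[of N] by (simp add: step_def)
  have leib: "leibniz_rule A A D N" for N by (rule step_below[OF D lin])
  have D0: "D 0 = (\<lambda>x\<in>carrier A. x)" using D[of 0] by (simp add: step_def)
  have "D \<in> HS k A"
    unfolding HS_def mem_Collect_eq
    by (intro conjI allI ballI) (rule lin D0 leibniz_ruleD[OF leib], assumption?)+
  moreover have "D 1 = \<delta>" using D[of 1] by (simp add: step_def)
  ultimately show ?thesis using \<delta> unfolding IDer_def by blast
qed

text \<open>Derivations with image in \<open>J\<close> are closed under the three operations that generate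
\<open>J Der\<^sub>k(A)\<close>.\<close>

lemma ideal_smult_Der:
  assumes "u \<in> ideal_smult J (Der k A)"
  shows "u \<in> carrier (Der k A) \<and> u ` carrier A \<subseteq> J"
proof -
  have DerD: "d \<in> linear_maps k A" "\<And>x y. x \<in> carrier A \<Longrightarrow> y \<in> carrier A
      \<Longrightarrow> d (x \<otimes>\<^bsub>A\<^esub> y) = (d x \<otimes>\<^bsub>A\<^esub> y) \<oplus>\<^bsub>A\<^esub> (x \<otimes>\<^bsub>A\<^esub> d y)"
    if "d \<in> carrier (Der k A)" for d
    using that by (auto simp: Der_def)
  have DerI: "d \<in> carrier (Der k A)" if "d \<in> linear_maps k A"
    "\<And>x y. x \<in> carrier A \<Longrightarrow> y \<in> carrier A
      \<Longrightarrow> d (x \<otimes>\<^bsub>A\<^esub> y) = (d x \<otimes>\<^bsub>A\<^esub> y) \<oplus>\<^bsub>A\<^esub> (x \<otimes>\<^bsub>A\<^esub> d y)" for d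
    using that by (simp add: Der_def)
  show ?thesis
    using assms
  proof (induction rule: ideal_smult.induct)
    case zero
    have eq: "\<zero>\<^bsub>Der k A\<^esub> = (\<lambda>x\<in>carrier A. \<zero>\<^bsub>A\<^esub>)" by (simp add: Der_def)
    have "(\<lambda>x\<in>carrier A. \<zero>\<^bsub>A\<^esub>) \<in> carrier (Der k A)"
      by (intro DerI linear_mapsI) (simp_all add: const_closed)
    moreover have "(\<lambda>x\<in>carrier A. \<zero>\<^bsub>A\<^esub>) ` carrier A \<subseteq> J" by auto
    ultimately show ?case unfolding eq by blast
  next
    case (smult a d)
    have eq: "a \<odot>\<^bsub>Der k A\<^esub> d = (\<lambda>x\<in>carrier A. a \<otimes>\<^bsub>A\<^esub> d x)" by (simp add: Der_def)
    have a: "a \<in> carrier A" using smult(1) by (rule J.Icarr)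
    note lin = linear_mapsD[OF DerD(1)[OF smult(2)]]
    have "(\<lambda>x\<in>carrier A. a \<otimes>\<^bsub>A\<^esub> d x) \<in> carrier (Der k A)"
    proof (intro DerI linear_mapsI)
      fix x y assume xy: "x \<in> carrier A" "y \<in> carrier A"
      have "u \<otimes>\<^bsub>A\<^esub> (b \<otimes>\<^bsub>A\<^esub> y \<oplus>\<^bsub>A\<^esub> x \<otimes>\<^bsub>A\<^esub> c) = u \<otimes>\<^bsub>A\<^esub> b \<otimes>\<^bsub>A\<^esub> y \<oplus>\<^bsub>A\<^esub> x \<otimes>\<^bsub>A\<^esub> (u \<otimes>\<^bsub>A\<^esub> c)"
        if "u \<in> carrier A" "b \<in> carrier A" "c \<in> carrier A" for u b c
        using that xy by (simp add: A.r_distr A.m_ac)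
      then show "(\<lambda>x\<in>carrier A. a \<otimes>\<^bsub>A\<^esub> d x) (x \<otimes>\<^bsub>A\<^esub> y)
          = (\<lambda>x\<in>carrier A. a \<otimes>\<^bsub>A\<^esub> d x) x \<otimes>\<^bsub>A\<^esub> y \<oplus>\<^bsub>A\<^esub> x \<otimes>\<^bsub>A\<^esub> (\<lambda>x\<in>carrier A. a \<otimes>\<^bsub>A\<^esub> d x) y"
        using xy a lin(1) by (simp add: DerD(2)[OF smult(2)])
    next
      fix c x assume "c \<in> carrier k" "x \<in> carrier A"
      then show "(\<lambda>x\<in>carrier A. a \<otimes>\<^bsub>A\<^esub> d x) (proj (const c) \<otimes>\<^bsub>A\<^esub> x)
          = proj (const c) \<otimes>\<^bsub>A\<^esub> (\<lambda>x\<in>carrier A. a \<otimes>\<^bsub>A\<^esub> d x) x"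
        using a lin(1,3) const_closed by (simp add: A.m_lcomm)
    qed (use a lin(1,2) in \<open>simp_all add: A.r_distr\<close>)
    moreover have "(\<lambda>x\<in>carrier A. a \<otimes>\<^bsub>A\<^esub> d x) ` carrier A \<subseteq> J"
      using smult(1) lin(1) J.I_r_closed by auto
    ultimately show ?case unfolding eq by blast
  next
    case (add u v)
    have eq: "u \<oplus>\<^bsub>Der k A\<^esub> v = (\<lambda>x\<in>carrier A. u x \<oplus>\<^bsub>A\<^esub> v x)" by (simp add: Der_def)
    note uD = DerD[OF conjunct1[OF add.IH(1)]] and vD = DerD[OF conjunct1[OF add.IH(2)]]
    note ulin = linear_mapsD[OF uD(1)] and vlin = linear_mapsD[OF vD(1)]
    have "(\<lambda>x\<in>carrier A. u x \<oplus>\<^bsub>A\<^esub> v x) \<in> carrier (Der k A)"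
    proof (intro DerI linear_mapsI)
      fix x y assume "x \<in> carrier A" "y \<in> carrier A"
      then show "(\<lambda>x\<in>carrier A. u x \<oplus>\<^bsub>A\<^esub> v x) (x \<otimes>\<^bsub>A\<^esub> y)
          = (\<lambda>x\<in>carrier A. u x \<oplus>\<^bsub>A\<^esub> v x) x \<otimes>\<^bsub>A\<^esub> y
            \<oplus>\<^bsub>A\<^esub> x \<otimes>\<^bsub>A\<^esub> (\<lambda>x\<in>carrier A. u x \<oplus>\<^bsub>A\<^esub> v x) y"
        using ulin(1) vlin(1) by (simp add: uD(2) vD(2) A.l_distr A.r_distr A.a_ac)
    next
      fix c x assume "c \<in> carrier k" "x \<in> carrier A"
      then show "(\<lambda>x\<in>carrier A. u x \<oplus>\<^bsub>A\<^esub> v x) (proj (const c) \<otimes>\<^bsub>A\<^esub> x)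
          = proj (const c) \<otimes>\<^bsub>A\<^esub> (\<lambda>x\<in>carrier A. u x \<oplus>\<^bsub>A\<^esub> v x) x"
        using ulin(1,3) vlin(1,3) const_closed by (simp add: A.r_distr)
    qed (use ulin(1,2) vlin(1,2) in \<open>simp_all add: A.a_ac\<close>)
    moreover have "(\<lambda>x\<in>carrier A. u x \<oplus>\<^bsub>A\<^esub> v x) ` carrier A \<subseteq> J"
      using add.IH by (auto intro!: J.a_closed)
    ultimately show ?case unfolding eq by blast
  qed
qed

end

theorem theorem5p1:
  fixes k :: "('a, 'm) ring_scheme" and n r :: nat
    and f :: "nat \<Rightarrow> nat multiset \<Rightarrow> 'a"
    and R :: "('a, nat multiset \<Rightarrow> 'a) module"
    and I :: "(nat multiset \<Rightarrow> 'a) set"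
    and A :: "('a, (nat multiset \<Rightarrow> 'a) set) module"
    and J :: "(nat multiset \<Rightarrow> 'a) set set"
  assumes "cring k"
    and "R = mpoly_algebra k n"
    and "\<forall>i<r. f i \<in> carrier R"
    and "I = Idl\<^bsub>R\<^esub> (f ` {..<r})"
    and "A = FactAlgebra R I"
    and "J = Fitting_ideal k n r f r"
  shows "(\<forall>\<delta> \<in> carrier (Der k A). \<delta> ` carrier A \<subseteq> J \<longrightarrow> \<delta> \<in> IDer k A) \<and>
         ideal_smult J (Der k A) \<subseteq> IDer k A"
proof -
  interpret P: presented_algebra k n r f
    using assms(1-3) by (intro presented_algebra.intro) simp_all
  show ?thesis
    unfolding assms(5,6,4) assms(2)
    using P.integrable_if_image_in_J P.ideal_smult_Der by blast
qed

end
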